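(* For any $n \geq 1$ and any $n$-simplex $T$, the set of degrees of freedom $D_T^{(n+1,n)}$ is $P_T^{(n+1,n)}$-unisolvent; that is, the number of elements of $D_T^{(n+1,n)}$ equals $\dim P_T^{(n+1,n)}$, and the only $v\in P_T^{(n+1,n)}$ with $d(v)=0$ for all $d\in D_T^{(n+1,n)}$ is $v=0$.
   Context: Let $T\subset\mathbb{R}^n$ be a (nondegenerate) $n$-simplex with vertices $a_1,\dots,a_{n+1}$ and barycentric coordinates $\lambda_1,\dots,\lambda_{n+1}$. $\mathcal{P}_k(T)$ denotes the polynomials on $T$ of degree at most $k$, and $q_T=\lambda_1\lambda_2\cdots\lambda_{n+1}$. The shape function space is $$P_T^{(n+1,n)}:=\mathcal{P}_{n+1}(T)+q_T\mathcal{P}_1(T).$$ For $1\le k\le n$, $\mathcal{F}_{T,k}$ is the set of all $(n-k)$-dimensional sub-simplexes of $T$. For $F\in\mathcal{F}_{T,k}$, $|F|$ is its $(n-k)$-dimensional measure ($|F|=1$ and $\int_F$ is point evaluation when $F$ is a vertex, i.e. $k=n$), and $\nu_{F,1},\dots,\nu_{F,k}$ are fixed linearly independent unit vectors orthogonal to the tangent space of $F$. $A_k$ is the set of multi-indices $\boldsymbol{\alpha}=(\alpha_1,\dots,\alpha_n)$ with $\sum_{i=k+1}^n\alpha_i=0$. For $F\in\mathcal{F}_{T,k}$ and $\boldsymbol{\alpha}\in A_k$ with $|\boldsymbol{\alpha}|=n+1-k$ set $$d_{T,F,\boldsymbol{\alpha}}(v):=\frac{1}{|F|}\int_F\frac{\partial^{n+1-k}v}{\partial\nu_{F,1}^{\alpha_1}\cdots\partial\nu_{F,k}^{\alpha_k}},\qquad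 d_{T,a_i,0}(v):=v(a_i).$$ The set of degrees of freedom is $$D_T^{(n+1,n)}:=\{d_{T,F,\boldsymbol{\alpha}}:\ \boldsymbol{\alpha}\in A_k,\ |\boldsymbol{\alpha}|=n+1-k,\ F\in\mathcal{F}_{T,k},\ 1\le k\le n\}\cup\{d_{T,a_i,0}:\ 1\le i\le n+1\},$$ counted as an indexed family. *)

theory Defs
  imports "HOL-Analysis.Analysis" "HOL-Library.Function_Algebras"
begin

section \<open>Polynomial spaces\<close>

interpretation fun_space: vector_space "\<lambda>(c::real) (f::'a \<Rightarrow> real) x. c * f x"
  by unfold_locales (auto simp: fun_eq_iff algebra_simps)

text \<open>
  A polynomial on a nondegenerate simplex is identified with its unique extension to a polynomial
  function on the whole space; the normal derivatives below need values off the face anyway.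
\<close>

definition polys_upto :: "nat \<Rightarrow> (real^'n \<Rightarrow> real) set" where
  "polys_upto k = fun_space.span {(\<lambda>x. \<Prod>i\<in>UNIV. (x $ i) ^ m i) | m. (\<Sum>i\<in>UNIV. m i) \<le> k}"

section \<open>Simplices\<close>

definition vertices :: "'a::euclidean_space set \<Rightarrow> 'a set" where
  "vertices T = {a. a extreme_point_of T}"

definition barycentric :: "'a::euclidean_space set \<Rightarrow> 'a \<Rightarrow> 'a \<Rightarrow> real" where
  "barycentric T a x =
     (THE u. (\<forall>b. b \<notin> vertices T \<longrightarrow> u b = 0) \<and> (\<Sum>b\<in>vertices T. u b) = 1 \<and>
             (\<Sum>b\<in>vertices T. u b *\<^sub>R b) = x) a"

definition bubble :: "'a::euclidean_space set \<Rightarrow> 'a \<Rightarrow> real" where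
  "bubble T x = (\<Prod>a\<in>vertices T. barycentric T a x)"

definition shape_space :: "(real^'n) set \<Rightarrow> (real^'n \<Rightarrow> real) set" where
  "shape_space T =
     {(\<lambda>x. p x + bubble T x * r x) | p r. p \<in> polys_upto (CARD('n) + 1) \<and> r \<in> polys_upto 1}"

text \<open>Sub-simplexes of codimension \<open>k\<close>; only used for \<open>k \<le> CARD('n)\<close>.\<close>

definition faces_codim :: "(real^'n) set \<Rightarrow> nat \<Rightarrow> (real^'n) set set" where
  "faces_codim T k = {convex hull S | S. S \<subseteq> vertices T \<and> card S = CARD('n) - k + 1}"

section \<open>Integration over a face\<close>

definition tangent_space :: "'a::euclidean_space set \<Rightarrow> 'a set" where
  "tangent_space F = span {x - y | x y. x \<in> F \<and> y \<in> F}"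

definition orthonormal_basis :: "'a::euclidean_space set \<Rightarrow> 'a set \<Rightarrow> bool" where
  "orthonormal_basis V B \<longleftrightarrow> pairwise orthogonal B \<and> (\<forall>b\<in>B. norm b = 1) \<and> span B = V"

text \<open>
  The Lebesgue measure of the affine hull of \<open>F\<close>, transported by the isometry
  \<open>t \<mapsto> p + (\<Sum>b\<in>B. t b *\<^sub>R b)\<close> where \<open>p \<in> F\<close> and \<open>B\<close> is an orthonormal basis of the tangent space;
  with \<open>B = Basis\<close> and \<open>p = 0\<close> it is the library's definition of \<^const>\<open>lborel\<close>.  By invariance of
  Lebesgue measure under isometries it does not depend on the choices of \<open>p\<close> and \<open>B\<close>.
  If \<open>F\<close> is a single point then \<open>B = {}\<close> and this is the Dirac measure at that point.
\<close>

definition face_measure :: "'a::euclidean_space set \<Rightarrow> 'a measure" where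
  "face_measure F =
     (let p = (SOME p. p \<in> F); B = (SOME B. orthonormal_basis (tangent_space F) B)
      in distr (\<Pi>\<^sub>M b\<in>B. (lborel :: real measure)) borel (\<lambda>t. p + (\<Sum>b\<in>B. t b *\<^sub>R b)))"

definition face_mean :: "'a::euclidean_space set \<Rightarrow> ('a \<Rightarrow> real) \<Rightarrow> real" where
  "face_mean F g = 1 / measure (face_measure F) F * (LINT x:F|face_measure F. g x)"

lemma orthonormal_basis_exists:
  fixes F :: "'a::euclidean_space set"
  shows "\<exists>B. orthonormal_basis (tangent_space F) B"
proof -
  have "subspace (tangent_space F)"
    by (simp add: tangent_space_def)
  then show ?thesis
    by (rule orthonormal_basis_subspace) (auto simp: orthonormal_basis_def)
qed

lemma face_mean_singleton:
  fixes a :: "'a::euclidean_space"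
  shows "measure (face_measure {a}) {a} = 1" and "face_mean {a} g = g a"
proof -
  have t: "tangent_space {a} = {0}"
    by (simp add: tangent_space_def)
  define B where "B = (SOME B. orthonormal_basis (tangent_space {a}) B)"
  have o: "orthonormal_basis {0} B"
    unfolding B_def t[symmetric] by (rule someI_ex) (rule orthonormal_basis_exists)
  then have "B \<subseteq> {0}"
    using span_superset[of B] by (simp add: orthonormal_basis_def)
  with o have B: "B = {}"
    by (force simp: orthonormal_basis_def)
  have eq: "face_measure {a} =
      distr (count_space {\<lambda>_::'a. undefined :: real}) borel (\<lambda>t. a)"
    unfolding face_measure_def Let_def B_def[symmetric] B by (simp add: PiM_empty)
  show m: "measure (face_measure {a}) {a} = 1"
    unfolding eq by (subst measure_distr) (auto simp: vimage_def)
  have "(LINT x:{a}|face_measure {a}. g x) = (LINT x|face_measure {a}. indicator {a} x * g a)"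
    unfolding set_lebesgue_integral_def
    by (rule Bochner_Integration.integral_cong) (auto simp: indicator_def)
  also have "\<dots> = g a"
    using m by (simp add: eq)
  finally show "face_mean {a} g = g a"
    using m by (simp add: face_mean_def)
qed

section \<open>Degrees of freedom\<close>

definition dir_deriv :: "'a::real_normed_vector \<Rightarrow> ('a \<Rightarrow> real) \<Rightarrow> 'a \<Rightarrow> real" where
  "dir_deriv w v x = deriv (\<lambda>t. v (x + t *\<^sub>R w)) 0"

definition mixed_deriv ::
    "(nat \<Rightarrow> 'a::real_normed_vector) \<Rightarrow> nat \<Rightarrow> (nat \<Rightarrow> nat) \<Rightarrow> ('a \<Rightarrow> real) \<Rightarrow> 'a \<Rightarrow> real" where
  "mixed_deriv w k \<alpha> = foldr (\<lambda>i. dir_deriv (w i) ^^ \<alpha> i) [1..<Suc k]"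

text \<open>A multi-index \<open>(\<alpha>\<^sub>1, \<dots>, \<alpha>\<^sub>n)\<close> is a function that vanishes outside \<open>{1..n}\<close>.\<close>

definition multi_indices :: "nat \<Rightarrow> nat \<Rightarrow> (nat \<Rightarrow> nat) set" where
  "multi_indices n k = {\<alpha>. (\<forall>i. i \<notin> {1..n} \<longrightarrow> \<alpha> i = 0) \<and> (\<Sum>i=k+1..n. \<alpha> i) = 0}"

text \<open>\<open>normal_frame T \<nu>\<close>: an admissible choice of the unit normals \<open>\<nu>\<^bsub>F,1\<^esub>, \<dots>, \<nu>\<^bsub>F,k\<^esub>\<close> for all faces.\<close>

definition normal_frame :: "(real^'n) set \<Rightarrow> ((real^'n) set \<Rightarrow> nat \<Rightarrow> real^'n) \<Rightarrow> bool" where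
  "normal_frame T \<nu> \<longleftrightarrow>
     (\<forall>k\<in>{1..CARD('n)}. \<forall>F\<in>faces_codim T k.
        (\<forall>i\<in>{1..k}. norm (\<nu> F i) = 1 \<and> (\<forall>t\<in>tangent_space F. orthogonal (\<nu> F i) t)) \<and>
        inj_on (\<nu> F) {1..k} \<and> independent (\<nu> F ` {1..k}))"

datatype 'a dof_index =
    Face_Dof nat "'a set" "nat \<Rightarrow> nat"
  | Vertex_Dof 'a

definition dof_indices :: "(real^'n) set \<Rightarrow> (real^'n) dof_index set" where
  "dof_indices T =
     {Face_Dof k F \<alpha> | k F \<alpha>. 1 \<le> k \<and> k \<le> CARD('n) \<and> F \<in> faces_codim T k \<and>
        \<alpha> \<in> multi_indices CARD('n) k \<and> (\<Sum>i=1..CARD('n). \<alpha> i) = CARD('n) + 1 - k} \<union>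
     {Vertex_Dof a | a. a \<in> vertices T}"

fun dof :: "('a::euclidean_space set \<Rightarrow> nat \<Rightarrow> 'a) \<Rightarrow> 'a dof_index \<Rightarrow> ('a \<Rightarrow> real) \<Rightarrow> real" where
  "dof \<nu> (Face_Dof k F \<alpha>) v = face_mean F (mixed_deriv (\<nu> F) k \<alpha> v)"
| "dof \<nu> (Vertex_Dof a) v = v a"

definition unisolvent :: "'i set \<Rightarrow> ('i \<Rightarrow> ('a \<Rightarrow> real) \<Rightarrow> real) \<Rightarrow> ('a \<Rightarrow> real) set \<Rightarrow> bool" where
  "unisolvent I d P \<longleftrightarrow>
     finite I \<and> card I = fun_space.dim P \<and> (\<forall>v\<in>P. (\<forall>i\<in>I. d i v = 0) \<longrightarrow> v = (\<lambda>x. 0))"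

end

theory Submission
  imports Defs
begin

text \<open>
  By the divergence theorem on each face, vanishing of all degrees of freedom gives that on every
  sub-simplex with \<open>s\<close> vertices, \<open>1 \<le> s \<le> n + 1\<close>, all derivatives of order \<open>s\<close> of \<open>v\<close> have mean zero: a tangential
  derivative reduces to the facets, and purely normal ones are degrees of freedom.  These are
  the coefficients in the Kergin expansion of \<open>\<partial>\<^sub>t v\<close> at the vertices, for \<open>t = a\<^sub>i - a\<^sub>j\<close>, so for \<open>x\<close> on the
  edge from \<open>a\<^sub>j\<close> to \<open>a\<^sub>i\<close> only the remainder survives, which for \<open>v = p + q\<^sub>T r\<close> is a nonzero multiple of
  \<open>\<tau> (1 - \<tau>) \<partial>\<^sub>t r\<close> at \<open>x = a\<^sub>j + \<tau> t\<close>.  Since \<open>v\<close> vanishes at the vertices, Rolle's theorem gives \<open>\<partial>\<^sub>t r = 0\<close> for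
  every edge, so \<open>r\<close> is constant and \<open>v\<close> has degree at most \<open>n + 1\<close>.  Then the derivatives of order \<open>s\<close> are
  constants with mean zero for \<open>s = n + 1, n, \<dots>, 1\<close> in turn, so \<open>v\<close> is constant, hence zero.  The same remainder
  shows that the functions \<open>q\<^sub>T x\<^sub>i\<close> are independent modulo polynomials of degree at most \<open>n + 1\<close>, and the
  dimension count is Vandermonde's identity.
\<close>

section \<open>Integration over simplices\<close>

text \<open>The vectors form a family over \<open>J\<close>, so one notion covers both coordinate
  systems on a face: an orthonormal basis with \<open>w = id\<close>, and the edges
  \<open>j - b\<close> indexed by the vertices other than \<open>b\<close>.\<close>

definition comb :: "('i \<Rightarrow> 'a::real_vector) \<Rightarrow> 'i set \<Rightarrow> ('i \<Rightarrow> real) \<Rightarrow> 'a" where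
  "comb w J t = (\<Sum>j\<in>J. t j *\<^sub>R w j)"

abbreviation lb :: "'i set \<Rightarrow> ('i \<Rightarrow> real) measure" where
  "lb J \<equiv> \<Pi>\<^sub>M j\<in>J. (lborel :: real measure)"

interpretation lb: product_sigma_finite "\<lambda>_. lborel :: real measure"
  by standard

section \<open>Translation invariance and uniqueness of Lebesgue measure on a subspace\<close>

lemma sigma_finite_lb: "finite J \<Longrightarrow> sigma_finite_measure (lb J)"
  by (rule lb.sigma_finite)

lemma comb_measurable [measurable]:
  fixes w :: "'i \<Rightarrow> 'a::euclidean_space"
  shows "comb w J \<in> borel_measurable (lb J)"
  unfolding comb_def by measurable

lemma comb_translate: "comb w J (\<lambda>j\<in>J. t j + s j) = comb w J t + comb w J s"
  by (simp add: comb_def scaleR_add_left sum.distrib)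

text \<open>A product measure is determined by its values on boxes, which reduces the claim to
  translation invariance on the line in each coordinate. The restriction to \<open>J\<close> keeps
  the shifted function extensional, as points of the product space must be.\<close>

lemma distr_lb_translate:
  fixes J :: "'i set"
  assumes J: "finite J"
  shows "distr (lb J) (lb J) (\<lambda>t. \<lambda>j\<in>J. t j + s j) = lb J"
proof (rule lb.PiM_eqI[OF J])
  fix A :: "'i \<Rightarrow> real set"
  assume "\<And>i. i \<in> J \<Longrightarrow> A i \<in> sets lborel"
  then have A: "A i \<in> sets borel" if "i \<in> J" for i
    using that by auto
  have "emeasure (distr (lb J) (lb J) (\<lambda>t. \<lambda>j\<in>J. t j + s j)) (Pi\<^sub>E J A) =
      emeasure (lb J) ((\<lambda>t. \<lambda>j\<in>J. t j + s j) -` Pi\<^sub>E J A \<inter> space (lb J))"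
    using A J by (intro emeasure_distr measurable_restrict sets_PiM_I_finite) auto
  also have "(\<lambda>t. \<lambda>j\<in>J. t j + s j) -` Pi\<^sub>E J A \<inter> space (lb J) = Pi\<^sub>E J (\<lambda>j. (\<lambda>x. s j + x) -` A j)"
    by (auto simp: space_PiM PiE_iff add.commute)
  also have "emeasure (lb J) \<dots> = (\<Prod>j\<in>J. emeasure lborel ((\<lambda>x. s j + x) -` A j))"
  proof (rule lb.emeasure_PiM[OF J])
    fix j assume "j \<in> J"
    then show "(\<lambda>x. s j + x) -` A j \<in> sets lborel"
      using measurable_sets_borel[of "\<lambda>x. s j + x" borel "A j"] A by auto
  qed
  also have "\<dots> = (\<Prod>j\<in>J. emeasure lborel (A j))"
  proof (rule prod.cong[OF refl])
    fix j assume "j \<in> J"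
    then have "emeasure lborel (A j) = emeasure (distr lborel borel (\<lambda>x. s j + x)) (A j)"
      by (simp add: lborel_distr_plus)
    also have "\<dots> = emeasure lborel ((\<lambda>x. s j + x) -` A j)"
      using A \<open>j \<in> J\<close> by (subst emeasure_distr) auto
    finally show "emeasure lborel ((\<lambda>x. s j + x) -` A j) = emeasure lborel (A j)" ..
  qed
  finally show "emeasure (distr (lb J) (lb J) (\<lambda>t. \<lambda>j\<in>J. t j + s j)) (Pi\<^sub>E J A) =
      (\<Prod>j\<in>J. emeasure lborel (A j))" .
qed auto

lemma nn_integral_lb_translate:
  fixes w :: "'i \<Rightarrow> 'a::euclidean_space"
  assumes J: "finite J" and [measurable]: "f \<in> borel_measurable borel"
    and v: "v \<in> span (w ` J)" and inj: "inj_on w J"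
  shows "(\<integral>\<^sup>+t. f (comb w J t + v) \<partial>lb J) = (\<integral>\<^sup>+t. f (comb w J t) \<partial>lb J)"
proof -
  obtain u where "v = (\<Sum>x\<in>w ` J. u x *\<^sub>R x)"
    using v J by (auto simp: span_finite)
  then have s: "v = comb w J (u \<circ> w)"
    using inj by (simp add: comb_def sum.reindex)
  have "(\<integral>\<^sup>+t. f (comb w J t) \<partial>lb J) =
      (\<integral>\<^sup>+t. f (comb w J t) \<partial>distr (lb J) (lb J) (\<lambda>t. \<lambda>j\<in>J. t j + (u \<circ> w) j))"
    by (simp only: distr_lb_translate[OF J])
  also have "\<dots> = (\<integral>\<^sup>+t. f (comb w J (\<lambda>j\<in>J. t j + (u \<circ> w) j)) \<partial>lb J)"
    by (rule nn_integral_distr) measurable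
  finally show ?thesis
    by (simp only: comb_translate s)
qed

lemma comb_in_span: "comb w J t \<in> span (w ` J)"
  unfolding comb_def by (intro span_sum span_scale span_base) auto

text \<open>The uniqueness argument for Haar measure: substitute \<open>x + y\<close> for \<open>x\<close>, then \<open>y - x\<close> for \<open>y\<close>.\<close>

lemma nn_integral_comb_proportional:
  fixes w :: "'i \<Rightarrow> 'a::euclidean_space" and z :: "'k \<Rightarrow> 'a"
  assumes J: "finite J" and K: "finite K" and [measurable]: "f \<in> borel_measurable borel" "g \<in> borel_measurable borel"
    and inj: "inj_on w J" "inj_on z K" and span: "span (w ` J) = span (z ` K)"
  shows "(\<integral>\<^sup>+t. f (comb w J t) \<partial>lb J) * (\<integral>\<^sup>+s. g (- comb z K s) \<partial>lb K) =
      (\<integral>\<^sup>+s. f (comb z K s) \<partial>lb K) * (\<integral>\<^sup>+t. g (comb w J t) \<partial>lb J)"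
proof -
  interpret P: pair_sigma_finite "lb J" "lb K"
    unfolding pair_sigma_finite_def using J K by (simp add: sigma_finite_lb)
  let ?x = "comb w J" and ?y = "comb z K"
  have "(\<integral>\<^sup>+t. f (?x t) \<partial>lb J) * (\<integral>\<^sup>+s. g (- ?y s) \<partial>lb K) =
      (\<integral>\<^sup>+s. (\<integral>\<^sup>+t. f (?x t) \<partial>lb J) * g (- ?y s) \<partial>lb K)"
    by (rule nn_integral_cmult[symmetric]) measurable
  also have "\<dots> = (\<integral>\<^sup>+s. (\<integral>\<^sup>+t. f (?x t + ?y s) * g (- ?y s) \<partial>lb J) \<partial>lb K)"
  proof (rule nn_integral_cong)
    fix s
    have "(\<integral>\<^sup>+t. f (?x t) \<partial>lb J) = (\<integral>\<^sup>+t. f (?x t + ?y s) \<partial>lb J)"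
      by (rule nn_integral_lb_translate[symmetric]) (use J inj span comb_in_span in auto)
    then show "(\<integral>\<^sup>+t. f (?x t) \<partial>lb J) * g (- ?y s) = (\<integral>\<^sup>+t. f (?x t + ?y s) * g (- ?y s) \<partial>lb J)"
      by (simp add: nn_integral_multc)
  qed
  also have "\<dots> = (\<integral>\<^sup>+t. (\<integral>\<^sup>+s. f (?x t + ?y s) * g (- ?y s) \<partial>lb K) \<partial>lb J)"
    by (rule P.Fubini') measurable
  also have "\<dots> = (\<integral>\<^sup>+t. (\<integral>\<^sup>+s. f (?y s) * g (?x t - ?y s) \<partial>lb K) \<partial>lb J)"
  proof (rule nn_integral_cong)
    fix t
    have "(\<integral>\<^sup>+s. (\<lambda>y. f y * g (?x t - y)) (?y s + ?x t) \<partial>lb K) = (\<integral>\<^sup>+s. (\<lambda>y. f y * g (?x t - y)) (?y s) \<partial>lb K)"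
      by (rule nn_integral_lb_translate) (use K inj span comb_in_span in auto)
    then show "(\<integral>\<^sup>+s. f (?x t + ?y s) * g (- ?y s) \<partial>lb K) = (\<integral>\<^sup>+s. f (?y s) * g (?x t - ?y s) \<partial>lb K)"
      by (simp add: add.commute)
  qed
  also have "\<dots> = (\<integral>\<^sup>+s. (\<integral>\<^sup>+t. f (?y s) * g (?x t - ?y s) \<partial>lb J) \<partial>lb K)"
    by (rule P.Fubini'[symmetric]) measurable
  also have "\<dots> = (\<integral>\<^sup>+s. f (?y s) * (\<integral>\<^sup>+t. g (?x t) \<partial>lb J) \<partial>lb K)"
  proof (rule nn_integral_cong)
    fix s
    have "(\<integral>\<^sup>+t. g (?x t + - ?y s) \<partial>lb J) = (\<integral>\<^sup>+t. g (?x t) \<partial>lb J)"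
      by (rule nn_integral_lb_translate) (use J inj span comb_in_span[of z K s] span_neg in auto)
    then show "(\<integral>\<^sup>+t. f (?y s) * g (?x t - ?y s) \<partial>lb J) = f (?y s) * (\<integral>\<^sup>+t. g (?x t) \<partial>lb J)"
      by (simp add: nn_integral_cmult)
  qed
  also have "\<dots> = (\<integral>\<^sup>+s. f (?y s) \<partial>lb K) * (\<integral>\<^sup>+t. g (?x t) \<partial>lb J)"
    by (rule nn_integral_multc) measurable
  finally show ?thesis .
qed

text \<open>By independence each coefficient is the value of a linear functional at the combination,
  and linear functionals are bounded in finite dimension. With right-hand side zero this is also the
  uniqueness of coefficients.\<close>

lemma comb_coordinate_bound:
  fixes w :: "'i \<Rightarrow> 'a::euclidean_space"
  assumes J: "finite J" and inj: "inj_on w J" and ind: "independent (w ` J)"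
  obtains C where "C > 0" "\<And>t j. j \<in> J \<Longrightarrow> \<bar>t j\<bar> \<le> C * norm (comb w J t)"
proof -
  have "\<exists>C>0. \<forall>t. \<bar>t j\<bar> \<le> C * norm (comb w J t)" if j: "j \<in> J" for j
  proof -
    obtain g :: "'a \<Rightarrow> real" where g: "linear g" "\<forall>x\<in>w ` J. g x = (if x = w j then 1 else 0)"
      using linear_independent_extend[OF ind, of "\<lambda>x. if x = w j then 1 else 0"] by auto
    have "g (comb w J t) = t j" for t
    proof -
      have "g (comb w J t) = (\<Sum>i\<in>J. t i * g (w i))"
        unfolding comb_def using g(1) by (simp add: linear_sum linear_cmul)
      also have "\<dots> = (\<Sum>i\<in>J. if i = j then t i else 0)"
        using g(2) inj j by (intro sum.cong) (auto simp: inj_on_def)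
      finally show ?thesis
        using J j by simp
    qed
    moreover obtain C where "C > 0" "\<And>x. norm (g x) \<le> C * norm x"
      using linear_bounded_pos[OF g(1)] by blast
    ultimately show ?thesis
      by (metis real_norm_def)
  qed
  then obtain C where C: "\<And>j. j \<in> J \<Longrightarrow> C j > 0" "\<And>j t. j \<in> J \<Longrightarrow> \<bar>t j\<bar> \<le> C j * norm (comb w J t)"
    by metis
  show thesis
  proof (rule that)
    \<comment> \<open>The summand 1 keeps the constant positive when \<open>J\<close> is
      empty.\<close>
    show "1 + (\<Sum>j\<in>J. C j) > 0"
      using C(1) by (intro add_pos_nonneg sum_nonneg) (auto intro: less_imp_le)
    fix t j assume j: "j \<in> J"
    have "C j \<le> 1 + (\<Sum>j\<in>J. C j)"
      using member_le_sum[of j J C] j C(1) J by (force intro: less_imp_le)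
    then show "\<bar>t j\<bar> \<le> (1 + (\<Sum>j\<in>J. C j)) * norm (comb w J t)"
      using C(2)[OF j, of t] by (meson dual_order.trans mult_right_mono norm_ge_zero)
  qed
qed

text \<open>The preimage of the unit ball lies between two boxes. Finiteness and positivity allow
  the mass of the ball to be cancelled when two parametrisations of the same face are
  compared.\<close>

lemma emeasure_comb_ball:
  fixes w :: "'i \<Rightarrow> 'a::euclidean_space"
  assumes J: "finite J" and inj: "inj_on w J" and ind: "independent (w ` J)"
  shows "(\<integral>\<^sup>+t. indicator (ball 0 1) (comb w J t) \<partial>lb J) < \<infinity>"
    and "(\<integral>\<^sup>+t. indicator (ball 0 1) (comb w J t) \<partial>lb J) > 0"
proof -
  let ?I = "(\<integral>\<^sup>+t. indicator (ball 0 1) (comb w J t) \<partial>lb J)"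
  have box: "emeasure (lb J) (Pi\<^sub>E J (\<lambda>_. {-r..r})) = ennreal (2 * r) ^ card J" if "r \<ge> 0" for r
    using J that by (subst lb.emeasure_PiM) auto
  have boxint: "(\<integral>\<^sup>+t. indicator (Pi\<^sub>E J (\<lambda>_. {-r..r})) t \<partial>lb J) = ennreal (2 * r) ^ card J" if "r \<ge> 0" for r
    using J that by (subst nn_integral_indicator) (auto simp: box intro!: sets_PiM_I_finite)
  obtain C where C: "C > 0" "\<And>t j. j \<in> J \<Longrightarrow> \<bar>t j\<bar> \<le> C * norm (comb w J t)"
    using comb_coordinate_bound[OF J inj ind] by metis
  have "?I \<le> (\<integral>\<^sup>+t. indicator (Pi\<^sub>E J (\<lambda>_. {-C..C})) t \<partial>lb J)"
  proof (rule nn_integral_mono)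
    fix t assume t: "t \<in> space (lb J)"
    have "\<bar>t j\<bar> \<le> C" if "j \<in> J" "norm (comb w J t) < 1" for j
    proof -
      have "C * norm (comb w J t) \<le> C"
        using C(1) that(2) by simp
      then show ?thesis
        using C(2)[OF that(1), of t] by linarith
    qed
    then show "indicator (ball 0 1) (comb w J t) \<le> (indicator (Pi\<^sub>E J (\<lambda>_. {-C..C})) t :: ennreal)"
      using t by (force simp: indicator_def space_PiM PiE_iff abs_le_iff)
  qed
  also have "\<dots> < \<infinity>"
    using C(1) by (simp add: boxint ennreal_power)
  finally show "?I < \<infinity>" .
  \<comment> \<open>Coefficients of size at most \<open>r\<close> give a vector of norm at most
    \<open>r * D\<close>, which is 1/2 for the choice of \<open>r\<close> below.\<close>
  define D where "D = 1 + (\<Sum>j\<in>J. norm (w j))"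
  have D: "D > 0"
    unfolding D_def by (intro add_pos_nonneg sum_nonneg) auto
  define r where "r = 1 / (2 * D)"
  have r: "r > 0"
    using D by (simp add: r_def)
  have "0 < ennreal (2 * r) ^ card J"
    using r by (simp add: ennreal_power)
  also have "\<dots> = (\<integral>\<^sup>+t. indicator (Pi\<^sub>E J (\<lambda>_. {-r..r})) t \<partial>lb J)"
    using r by (simp add: boxint)
  also have "\<dots> \<le> ?I"
  proof (rule nn_integral_mono)
    fix t
    have "norm (comb w J t) < 1" if "t \<in> Pi\<^sub>E J (\<lambda>_. {-r..r})"
    proof -
      have "norm (comb w J t) \<le> (\<Sum>j\<in>J. norm (t j *\<^sub>R w j))"
        unfolding comb_def by (rule norm_sum)
      also have "\<dots> \<le> (\<Sum>j\<in>J. r * norm (w j))"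
        using that by (intro sum_mono) (auto simp: PiE_iff abs_le_iff intro!: mult_right_mono)
      also have "\<dots> \<le> r * D"
        using r by (simp add: D_def sum_distrib_left algebra_simps)
      also have "\<dots> < 1"
        using D by (simp add: r_def)
      finally show ?thesis .
    qed
    then show "indicator (Pi\<^sub>E J (\<lambda>_. {-r..r})) t \<le> (indicator (ball 0 1) (comb w J t) :: ennreal)"
      by (auto simp: indicator_def)
  qed
  finally show "?I > 0" .
qed

section \<open>The Hermite-Genocchi functional on the standard simplex\<close>

definition std_simplex :: "'i set \<Rightarrow> ('i \<Rightarrow> real) set" where
  "std_simplex J = {u \<in> extensional J. (\<forall>j\<in>J. 0 \<le> u j) \<and> sum u J \<le> 1}"

lemma std_simplex_meas:
  assumes "finite J"
  shows "std_simplex J \<in> sets (lb J)" "emeasure (lb J) (std_simplex J) = ennreal (1 / fact (card J))"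
proof -
  have eq: "std_simplex J = {x. (\<forall>i\<in>J. 0 \<le> x i) \<and> sum x J \<le> 1} \<inter> space (lb J)"
    by (simp add: std_simplex_def space_PiM PiE_def Int_def conj_commute)
  have "std_simplex J = Pi\<^sub>E J (\<lambda>_. {0..}) \<inter> ((\<lambda>x. sum x J) -` {..1} \<inter> space (lb J))"
    by (auto simp: std_simplex_def space_PiM PiE_iff extensional_def)
  also have "\<dots> \<in> sets (lb J)"
    using assms by (intro sets.Int sets_PiM_I_finite measurable_sets[of _ _ borel] borel_measurable_sum) auto
  finally show "std_simplex J \<in> sets (lb J)" .
  show "emeasure (lb J) (std_simplex J) = ennreal (1 / fact (card J))"
    unfolding eq emeasure_std_simplex_aux[OF assms zero_le_one]
    by (simp flip: ennreal_fact add: divide_ennreal ennreal_1[symmetric] del: ennreal_1)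
qed

text \<open>The Hermite-Genocchi functional of the points \<open>insert b J\<close>, which may be affinely dependent.\<close>

definition simplex_integral :: "'a::euclidean_space set \<Rightarrow> 'a \<Rightarrow> ('a \<Rightarrow> real) \<Rightarrow> real" where
  "simplex_integral J b h =
     (LINT u|lb J. indicator (std_simplex J) u * h (b + comb (\<lambda>j. j - b) J u))"

text \<open>The point is the convex combination with weight \<open>u j\<close> at \<open>j\<close>
  and the remaining weight \<open>1 - sum u J\<close> at \<open>b\<close>.\<close>

lemma comb_std_simplex_in_hull:
  fixes b :: "'a::euclidean_space"
  assumes J: "finite J" and u: "u \<in> std_simplex J"
  shows "b + comb (\<lambda>j. j - b) J u \<in> convex hull (insert b J)"
proof -
  have "b + comb (\<lambda>j. j - b) J u = (1 - sum u J) *\<^sub>R b + (\<Sum>j\<in>J. u j *\<^sub>R j)"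
    by (simp add: comb_def algebra_simps sum_subtractf scaleR_left.sum)
  \<comment> \<open>Since \<open>b\<close> may lie in \<open>J\<close>, the weights are grouped as a
    point on the segment from \<open>b\<close> to the normalised combination of \<open>J\<close>. If
    \<open>sum u J = 0\<close>, all weights on \<open>J\<close> vanish and the division by zero is
    harmless.\<close>
  also have "\<dots> = (1 - sum u J) *\<^sub>R b + sum u J *\<^sub>R ((\<Sum>j\<in>J. (u j / sum u J) *\<^sub>R j))"
  proof (cases "sum u J = 0")
    case True
    have "u j = 0" if "j \<in> J" for j
      by (rule sum_nonneg_0[OF J _ True that]) (use u in \<open>simp add: std_simplex_def\<close>)
    then show ?thesis
      by simp
  qed (simp add: scaleR_right.sum)
  also have "\<dots> \<in> convex hull (insert b J)"
  proof (cases "sum u J = 0")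
    case True
    then show ?thesis
      by (simp add: hull_inc)
  next
    case False
    have pos: "0 \<le> sum u J"
      using u by (auto simp: std_simplex_def intro!: sum_nonneg)
    have "(\<Sum>j\<in>J. (u j / sum u J) *\<^sub>R j) \<in> convex hull (insert b J)"
    proof (rule convex_sum[OF J convex_convex_hull])
      show "(\<Sum>j\<in>J. u j / sum u J) = 1"
        using False by (simp flip: sum_divide_distrib)
    qed (use pos u in \<open>auto simp: std_simplex_def hull_inc\<close>)
    then show ?thesis
      using pos u by (intro convexD[OF convex_convex_hull]) (auto simp: std_simplex_def hull_inc)
  qed
  finally show ?thesis .
qed

text \<open>The hull of finitely many points is compact, so the continuous integrand is bounded on a
  set of finite measure.\<close>

lemma simplex_integrand_integrable:
  fixes b :: "'a::euclidean_space" and h :: "'a \<Rightarrow> real"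
  assumes J: "finite J" and h: "continuous_on UNIV h"
  shows "integrable (lb J) (\<lambda>u. indicator (std_simplex J) u * h (b + comb (\<lambda>j. j - b) J u))"
proof -
  have [measurable]: "h \<in> borel_measurable borel"
    using h by (rule borel_measurable_continuous_onI)
  have "compact (h ` (convex hull (insert b J)))"
    using J by (intro compact_continuous_image continuous_on_subset[OF h] compact_convex_hull finite_imp_compact) auto
  then obtain B where B: "\<And>x. x \<in> convex hull (insert b J) \<Longrightarrow> norm (h x) \<le> B"
    by (meson bounded_iff compact_imp_bounded image_eqI)
  have "integrable (lb J) (\<lambda>u. indicator (std_simplex J) u *\<^sub>R h (b + comb (\<lambda>j. j - b) J u))"
  proof (rule integrableI_bounded_set_indicator)
    show "AE u in lb J. u \<in> std_simplex J \<longrightarrow> norm (h (b + comb (\<lambda>j. j - b) J u)) \<le> B"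
      using B comb_std_simplex_in_hull[OF J] by blast
  qed (use std_simplex_meas[OF J] in \<open>auto simp: ennreal_less_top\<close>)
  then show ?thesis
    by simp
qed

lemma simplex_integral_add:
  assumes "finite J" "continuous_on UNIV f" "continuous_on UNIV g"
  shows "simplex_integral J b (\<lambda>x. f x + g x) = simplex_integral J b f + simplex_integral J b g"
  using simplex_integrand_integrable[OF assms(1,2)] simplex_integrand_integrable[OF assms(1,3)]
  by (simp add: simplex_integral_def distrib_left)

lemma simplex_integral_cmult:
  "simplex_integral J b (\<lambda>x. c * f x) = c * simplex_integral J b f"
  by (simp add: simplex_integral_def mult.left_commute)

lemma simplex_integral_const:
  assumes "finite J"
  shows "simplex_integral J b (\<lambda>_. c) = c / fact (card J)"
  using std_simplex_meas[OF assms]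
  by (simp add: simplex_integral_def measure_def)

lemma simplex_integral_empty: "simplex_integral {} b h = h b"
  by (simp add: simplex_integral_def PiM_empty comb_def std_simplex_def lebesgue_integral_count_space_finite)

text \<open>Integrating over the coordinate of \<open>a\<close> first, the fundamental theorem of
  calculus leaves the difference of the integrals over the facets opposite \<open>b\<close> and
  opposite \<open>a\<close>. This is the divergence theorem for a constant field along an edge, and
  at the same time the recursion for divided differences; \<open>b\<close> is arbitrary, so the
  points may be affinely dependent.\<close>

lemma simplex_integral_derivative:
  fixes a b :: "'a::euclidean_space"
  assumes J: "finite J" and a: "a \<notin> J" and h: "continuous_on UNIV h" and h': "continuous_on UNIV h'"
    and deriv: "\<And>y. ((\<lambda>s. h (y + s *\<^sub>R (a - b))) has_real_derivative h' y) (at 0)"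
  shows "simplex_integral (insert a J) b h' = simplex_integral J a h - simplex_integral J b h"
proof -
  \<comment> \<open>The hypothesis gives the derivative only at parameter 0, but for every base
    point; moving the base point along the line gives it at every \<open>s\<close>.\<close>
  have deriv': "((\<lambda>s. h (y + s *\<^sub>R (a - b))) has_real_derivative h' (y + s *\<^sub>R (a - b))) (at s)" for y s
  proof -
    have "((\<lambda>r. (\<lambda>s. h (y + s *\<^sub>R (a - b))) (r + s)) has_real_derivative h' (y + s *\<^sub>R (a - b))) (at 0)"
      using deriv[of "y + s *\<^sub>R (a - b)"] by (simp add: algebra_simps)
    then show ?thesis
      using DERIV_shift[of "\<lambda>s. h (y + s *\<^sub>R (a - b))" "h' (y + s *\<^sub>R (a - b))" 0 s] by simp
  qed
  let ?w = "\<lambda>j. j - b"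
  \<comment> \<open>The slice of the larger simplex above a point \<open>u\<close> of the smaller
    one is the interval \<open>{0..1 - sum u J}\<close>.\<close>
  have split: "indicator (std_simplex (insert a J)) (u(a := s)) = indicator (std_simplex J) u * (indicator {0..1 - sum u J} s :: real)"
    if "u \<in> space (lb J)" for u s
  proof -
    have "u \<in> extensional J"
      using that by (simp add: space_PiM PiE_def)
    moreover have "sum (u(a := s)) (insert a J) = s + sum u J"
    proof -
      have "(\<Sum>j\<in>J. (u(a := s)) j) = sum u J"
        using a by (intro sum.cong) auto
      then show ?thesis
        using J a by (simp del: fun_upd_apply) simp
    qed
    moreover have "0 \<le> sum u J" if "\<forall>j\<in>J. 0 \<le> u j"
      using that by (simp add: sum_nonneg)
    ultimately show ?thesis
      using a by (auto simp: std_simplex_def indicator_def extensional_def)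
  qed
  have upd: "comb ?w (insert a J) (u(a := s)) = comb ?w J u + s *\<^sub>R (a - b)" for u s
  proof -
    have "(\<Sum>j\<in>J. (u(a := s)) j *\<^sub>R (j - b)) = (\<Sum>j\<in>J. u j *\<^sub>R (j - b))"
      using a by (intro sum.cong) auto
    then show ?thesis
      using J a by (simp add: comb_def add.commute)
  qed
  have "simplex_integral (insert a J) b h' =
      (LINT u|lb J. LINT s|lborel. indicator (std_simplex (insert a J)) (u(a := s)) *
        h' (b + comb ?w (insert a J) (u(a := s))))"
    unfolding simplex_integral_def
    by (rule lb.product_integral_insert) (use J a h' in \<open>auto intro!: simplex_integrand_integrable\<close>)
  also have "\<dots> = (LINT u|lb J. indicator (std_simplex J) u * h (a + comb (\<lambda>j. j - a) J u) -
      indicator (std_simplex J) u * h (b + comb ?w J u))"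
  proof (rule Bochner_Integration.integral_cong[OF refl])
    fix u assume u: "u \<in> space (lb J)"
    have "(LINT s|lborel. indicator (std_simplex (insert a J)) (u(a := s)) *
        h' (b + comb ?w (insert a J) (u(a := s)))) =
        indicator (std_simplex J) u * (LINT s|lborel. h' (b + comb ?w J u + s *\<^sub>R (a - b)) * indicator {0..1 - sum u J} s)"
      by (simp add: split[OF u] upd mult_ac add.assoc)
    also have "\<dots> = indicator (std_simplex J) u *
        (h (b + comb ?w J u + (1 - sum u J) *\<^sub>R (a - b)) - h (b + comb ?w J u))"
    proof (cases "u \<in> std_simplex J")
      case True
      have "(LINT s|lborel. h' (b + comb ?w J u + s *\<^sub>R (a - b)) * indicator {0..1 - sum u J} s) =
          h (b + comb ?w J u + (1 - sum u J) *\<^sub>R (a - b)) - h (b + comb ?w J u + 0 *\<^sub>R (a - b))"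
      proof (rule integral_FTC_Icc_real)
        show "isCont (\<lambda>s. h' (b + comb ?w J u + s *\<^sub>R (a - b))) s" for s
        proof -
          have "continuous_on UNIV (\<lambda>s. h' (b + comb ?w J u + s *\<^sub>R (a - b)))"
            by (rule continuous_on_compose2[OF h']) (auto intro!: continuous_intros)
          then show ?thesis
            by (simp add: continuous_on_eq_continuous_at)
        qed
      qed (use True deriv' in \<open>auto simp: std_simplex_def\<close>)
      then show ?thesis
        by simp
    qed simp
    \<comment> \<open>At the upper end of the slice \<open>b\<close> has weight zero, so the same
      coefficients describe the point with \<open>a\<close> as base point.\<close>
    also have "b + comb ?w J u + (1 - sum u J) *\<^sub>R (a - b) = a + comb (\<lambda>j. j - a) J u"
      by (simp add: comb_def algebra_simps sum_subtractf scaleR_left.sum)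
    finally show "(LINT s|lborel. indicator (std_simplex (insert a J)) (u(a := s)) *
        h' (b + comb ?w (insert a J) (u(a := s)))) =
        indicator (std_simplex J) u * h (a + comb (\<lambda>j. j - a) J u) - indicator (std_simplex J) u * h (b + comb ?w J u)"
      by (simp only: right_diff_distrib)
  qed
  also have "\<dots> = simplex_integral J a h - simplex_integral J b h"
    unfolding simplex_integral_def
    by (intro Bochner_Integration.integral_diff simplex_integrand_integrable J h)
  finally show ?thesis .
qed

section \<open>Edge coordinates and the mean over a face\<close>

lemma edge_independent:
  fixes S :: "'a::euclidean_space set"
  assumes S: "\<not> affine_dependent S" and b: "b \<in> S"
  shows "finite (S - {b})" "inj_on (\<lambda>j. j - b) (S - {b})" "independent ((\<lambda>j. j - b) ` (S - {b}))"
proof -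
  show "finite (S - {b})"
    using aff_independent_finite[OF S] by simp
  show "inj_on (\<lambda>j. j - b) (S - {b})"
    by (auto simp: inj_on_def)
  show "independent ((\<lambda>j. j - b) ` (S - {b}))"
    using S affine_dependent_iff_dependent2[OF b] by simp
qed

lemma tangent_space_simplex:
  fixes S :: "'a::euclidean_space set"
  assumes b: "b \<in> S"
  shows "tangent_space (convex hull S) = span ((\<lambda>j. j - b) ` (S - {b}))"
    and "x \<in> convex hull S \<Longrightarrow> x - b \<in> tangent_space (convex hull S)"
proof -
  let ?V = "span ((\<lambda>j. j - b) ` (S - {b}))"
  have V: "x - b \<in> ?V" if "x \<in> convex hull S" for x
  proof -
    have "x \<in> affine hull S"
      using that convex_hull_subset_affine_hull by blast
    then show ?thesis
      unfolding affine_hull_span2[OF b] by auto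
  qed
  have "x - y \<in> ?V" if "x \<in> convex hull S" "y \<in> convex hull S" for x y
    using span_diff[OF V[OF that(1)] V[OF that(2)]] by simp
  then have "tangent_space (convex hull S) \<subseteq> ?V"
    unfolding tangent_space_def by (intro span_minimal) auto
  moreover have "?V \<subseteq> tangent_space (convex hull S)"
    unfolding tangent_space_def using b hull_inc[of _ S convex] by (intro span_mono) blast
  ultimately show *: "tangent_space (convex hull S) = ?V"
    by blast
  show "x - b \<in> tangent_space (convex hull S)" if "x \<in> convex hull S"
    unfolding * by (rule V[OF that])
qed

text \<open>Affine independence makes the edge coordinates unique, so the convex weights of a point
  of the hull must agree with \<open>u\<close> away from \<open>b\<close>.\<close>

lemma std_simplex_iff_hull:
  fixes S :: "'a::euclidean_space set"
  assumes S: "\<not> affine_dependent S" and b: "b \<in> S" and u: "u \<in> extensional (S - {b})"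
  shows "b + comb (\<lambda>j. j - b) (S - {b}) u \<in> convex hull S \<longleftrightarrow> u \<in> std_simplex (S - {b})"
proof
  let ?J = "S - {b}"
  assume "b + comb (\<lambda>j. j - b) ?J u \<in> convex hull S"
  moreover have fin: "finite S"
    by (rule aff_independent_finite[OF S])
  ultimately obtain v where v: "\<forall>x\<in>S. 0 \<le> v x" "sum v S = 1" "(\<Sum>x\<in>S. v x *\<^sub>R x) = b + comb (\<lambda>j. j - b) ?J u"
    by (auto simp: convex_hull_finite)
  have v1: "sum v ?J = 1 - v b"
    using v(2) fin b by (simp add: sum_diff1)
  have "(\<Sum>x\<in>S. v x *\<^sub>R x) = v b *\<^sub>R b + (\<Sum>x\<in>?J. v x *\<^sub>R x)"
    using fin b by (simp add: sum.remove)
  also have "(\<Sum>x\<in>?J. v x *\<^sub>R x) = comb (\<lambda>j. j - b) ?J v + sum v ?J *\<^sub>R b"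
    by (simp add: comb_def scaleR_diff_right sum_subtractf scaleR_left.sum)
  finally have "comb (\<lambda>j. j - b) ?J u = comb (\<lambda>j. j - b) ?J v"
    using v(3) by (simp add: v1 algebra_simps)
  then have z: "comb (\<lambda>j. j - b) ?J (\<lambda>j. u j - v j) = 0"
    by (simp add: comb_def scaleR_diff_left sum_subtractf)
  obtain C where C: "C > 0" "\<And>t j. j \<in> ?J \<Longrightarrow> \<bar>t j\<bar> \<le> C * norm (comb (\<lambda>j. j - b) ?J t)"
    using comb_coordinate_bound[OF edge_independent[OF S b]] by metis
  have eq: "u j = v j" if "j \<in> ?J" for j
    using C(2)[OF that, of "\<lambda>j. u j - v j"] z by simp
  then have "sum u ?J = sum v ?J"
    by (rule sum.cong[OF refl])
  then show "u \<in> std_simplex ?J"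
    using u eq v(1) v1 b by (auto simp: std_simplex_def)
next
  assume "u \<in> std_simplex (S - {b})"
  then have "b + comb (\<lambda>j. j - b) (S - {b}) u \<in> convex hull (insert b (S - {b}))"
    using aff_independent_finite[OF S] by (intro comb_std_simplex_in_hull) auto
  then show "b + comb (\<lambda>j. j - b) (S - {b}) u \<in> convex hull S"
    using b by (simp add: insert_absorb)
qed

text \<open>Orthonormal coordinates and edge coordinates parametrise the same affine space, and both
  carry Lebesgue measure to a translation invariant measure, so the results are proportional. The
  value of the constant is left open because it cancels in a mean.\<close>

lemma face_measure_simplex:
  fixes S :: "'a::euclidean_space set"
  assumes S: "\<not> affine_dependent S" and b: "b \<in> S"
  obtains C where "C > 0" "face_measure (convex hull S) =
    density (distr (lb (S - {b})) borel (\<lambda>u. b + comb (\<lambda>j. j - b) (S - {b}) u)) (\<lambda>_. ennreal C)"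
proof -
  let ?F = "convex hull S" and ?J = "S - {b}" and ?w = "\<lambda>j. j - b"
  note J = edge_independent[OF S b]
  define p where "p = (SOME p. p \<in> ?F)"
  define B where "B = (SOME B. orthonormal_basis (tangent_space ?F) B)"
  have p: "p \<in> ?F"
    unfolding p_def by (rule someI[of _ b]) (simp add: b hull_inc)
  have B: "orthonormal_basis (tangent_space ?F) B"
    unfolding B_def by (rule someI_ex) (rule orthonormal_basis_exists)
  have indB: "independent (id ` B)"
    using B pairwise_orthogonal_independent[of B] by (force simp: orthonormal_basis_def)
  then have finB: "finite B"
    by (simp add: independent_bound)
  have span: "span (id ` B) = span (?w ` ?J)"
    using B tangent_space_simplex(1)[OF b] by (simp add: orthonormal_basis_def)
  have injB: "inj_on id B"
    by simp
  have pb: "b - p \<in> span (?w ` ?J)"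
    using tangent_space_simplex[OF b] p span_neg[of "p - b"] by force
  define cB where "cB = (\<integral>\<^sup>+t. indicator (ball 0 1) (comb id B t) \<partial>lb B)"
  define cJ where "cJ = (\<integral>\<^sup>+t. indicator (ball 0 1) (comb ?w ?J t) \<partial>lb ?J)"
  have cB: "cB > 0" "cB < \<infinity>"
    unfolding cB_def by (rule emeasure_comb_ball[OF finB injB indB])+
  have cJ: "cJ > 0" "cJ < \<infinity>"
    unfolding cJ_def by (rule emeasure_comb_ball[OF J])+
  \<comment> \<open>The ratio of the masses that the two parametrisations give to the unit
    ball.\<close>
  define C where "C = enn2real cB / enn2real cJ"
  have C: "C > 0"
    using cB cJ by (simp add: C_def enn2real_positive_iff)
  have cBC: "cB = ennreal C * cJ"
    using cB cJ by (cases cB; cases cJ) (auto simp: C_def ennreal_mult[symmetric])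
  let ?M = "distr (lb ?J) borel (\<lambda>u. b + comb ?w ?J u)"
  have M: "face_measure ?F = distr (lb B) borel (\<lambda>t. p + comb id B t)"
    by (simp add: face_measure_def Let_def p_def B_def comb_def)
  have "face_measure ?F = density ?M (\<lambda>_. ennreal C)"
  proof (rule measure_eqI)
    fix A :: "'a set" assume "A \<in> sets (face_measure ?F)"
    then have A[measurable]: "A \<in> sets borel"
      by (simp add: M)
    have [measurable]: "ball (0 :: 'a) 1 \<in> sets borel"
      by simp
    \<comment> \<open>\<open>nn_integral_comb_proportional\<close> is used with the indicator of
      \<open>A\<close>, shifted by \<open>p\<close>, and that of the unit ball, whose symmetry
      absorbs the minus sign. The base point is then moved from \<open>p\<close> to \<open>b\<close>
      by the tangent vector \<open>b - p\<close>.\<close>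
    have "emeasure (face_measure ?F) A * cJ = (\<integral>\<^sup>+t. indicator A (p + comb id B t) \<partial>lb B) * cJ"
      unfolding M by (simp add: nn_integral_distr flip: nn_integral_indicator)
    also have "\<dots> = (\<integral>\<^sup>+t. indicator A (p + comb id B t) \<partial>lb B) *
        (\<integral>\<^sup>+u. indicator (ball 0 1) (- comb ?w ?J u) \<partial>lb ?J)"
      by (simp add: cJ_def indicator_def)
    also have "\<dots> = (\<integral>\<^sup>+u. indicator A (p + comb ?w ?J u) \<partial>lb ?J) * cB"
      unfolding cB_def
      by (rule nn_integral_comb_proportional[OF finB J(1) _ _ injB J(2) span]) measurable
    also have "(\<integral>\<^sup>+u. indicator A (p + comb ?w ?J u) \<partial>lb ?J) =
        (\<integral>\<^sup>+u. indicator A (p + (comb ?w ?J u + (b - p))) \<partial>lb ?J)"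
      by (rule nn_integral_lb_translate[OF J(1) _ pb J(2), symmetric]) measurable
    also have "\<dots> = (\<integral>\<^sup>+u. indicator A (b + comb ?w ?J u) \<partial>lb ?J)"
      by (simp add: algebra_simps)
    also have "\<dots> = emeasure ?M A"
      by (simp add: nn_integral_distr flip: nn_integral_indicator)
    also have "emeasure ?M A * cB = (ennreal C * emeasure ?M A) * cJ"
      by (simp add: cBC mult_ac)
    finally have "emeasure (face_measure ?F) A = ennreal C * emeasure ?M A"
      using cJ by (auto simp: mult.commute[of _ cJ] ennreal_mult_cancel_left)
    also have "\<dots> = emeasure (density ?M (\<lambda>_. ennreal C)) A"
      by (simp add: emeasure_density nn_integral_cmult_indicator)
    finally show "emeasure (face_measure ?F) A = emeasure (density ?M (\<lambda>_. ennreal C)) A" .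
  qed (simp add: M)
  then show thesis
    using C that by blast
qed

text \<open>The unknown density cancels between integral and measure, and the factorial is the
  reciprocal of the volume of the standard simplex.\<close>

lemma face_mean_simplex:
  fixes S :: "'a::euclidean_space set"
  assumes S: "\<not> affine_dependent S" and b: "b \<in> S" and h: "continuous_on UNIV h"
  shows "face_mean (convex hull S) h = fact (card (S - {b})) * simplex_integral (S - {b}) b h"
proof -
  let ?F = "convex hull S" and ?J = "S - {b}" and ?w = "\<lambda>j. j - b"
  let ?M = "distr (lb ?J) borel (\<lambda>u. b + comb ?w ?J u)"
  have J: "finite ?J"
    using aff_independent_finite[OF S] by simp
  have [measurable]: "?F \<in> sets borel"
    using aff_independent_finite[OF S] by (intro borel_compact compact_convex_hull finite_imp_compact)
  have [measurable]: "h \<in> borel_measurable borel"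
    using h by (rule borel_measurable_continuous_onI)
  obtain C where C: "C > 0" "face_measure ?F = density ?M (\<lambda>_. ennreal C)"
    using face_measure_simplex[OF S b] by metis
  have ind: "indicator ?F (b + comb ?w ?J u) = (indicator (std_simplex ?J) u :: 'c::{zero_neq_one})"
    if "u \<in> space (lb ?J)" for u
    using std_simplex_iff_hull[OF S b, of u] that by (simp add: indicator_def space_PiM PiE_def)
  have int: "(LINT x:?F|face_measure ?F. h x) = C * simplex_integral ?J b h"
  proof -
    have "(LINT x:?F|face_measure ?F. h x) = (LINT x|?M. C * (indicator ?F x * h x))"
      unfolding C(2) set_lebesgue_integral_def using C(1) by (subst integral_density) auto
    also have "\<dots> = C * (LINT u|lb ?J. indicator ?F (b + comb ?w ?J u) * h (b + comb ?w ?J u))"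
      by (subst integral_distr) auto
    also have "\<dots> = C * simplex_integral ?J b h"
      unfolding simplex_integral_def by (simp add: ind cong: Bochner_Integration.integral_cong)
    finally show ?thesis .
  qed
  have "emeasure (face_measure ?F) ?F = ennreal C * emeasure ?M ?F"
    unfolding C(2) by (simp add: emeasure_density nn_integral_cmult_indicator)
  also have "emeasure ?M ?F = (\<integral>\<^sup>+u. indicator ?F (b + comb ?w ?J u) \<partial>lb ?J)"
    by (simp add: nn_integral_distr flip: nn_integral_indicator)
  also have "\<dots> = emeasure (lb ?J) (std_simplex ?J)"
    using std_simplex_meas[OF J] by (simp add: ind cong: nn_integral_cong)
  finally have "measure (face_measure ?F) ?F = C / fact (card ?J)"
    using C(1) std_simplex_meas(2)[OF J] by (simp add: measure_def ennreal_mult[symmetric])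
  then show ?thesis
    using C(1) int by (simp add: face_mean_def)
qed

section \<open>Directional derivatives of polynomials\<close>

lemma real_polynomial_function_const: "real_polynomial_function (\<lambda>x. c)"
  and real_polynomial_function_add: "\<lbrakk>real_polynomial_function f; real_polynomial_function g\<rbrakk> \<Longrightarrow> real_polynomial_function (\<lambda>x. f x + g x)"
  and real_polynomial_function_mult: "\<lbrakk>real_polynomial_function f; real_polynomial_function g\<rbrakk> \<Longrightarrow> real_polynomial_function (\<lambda>x. f x * g x)"
  by blast+

text \<open>Links the definition through \<open>deriv\<close>, which is total, to the Frechet
  derivative; the calculus rules for \<open>dir_deriv\<close> on polynomials follow from
  this.\<close>

lemma dir_deriv_eq:
  assumes "(f has_derivative f') (at x)"
  shows "((\<lambda>t. f (x + t *\<^sub>R w)) has_real_derivative f' w) (at 0)" and "dir_deriv w f x = f' w"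
proof -
  have "((\<lambda>t. x + t *\<^sub>R w) has_derivative (\<lambda>t. t *\<^sub>R w)) (at 0)"
    by (auto intro!: derivative_eq_intros)
  then have "((\<lambda>t. f (x + t *\<^sub>R w)) has_derivative (\<lambda>t. f' (t *\<^sub>R w))) (at 0)"
    by (rule has_derivative_compose) (use assms in simp)
  moreover have "(\<lambda>t. f' (t *\<^sub>R w)) = (*) (f' w)"
    using assms by (auto simp: fun_eq_iff linear_cmul has_derivative_linear)
  ultimately show "((\<lambda>t. f (x + t *\<^sub>R w)) has_real_derivative f' w) (at 0)"
    by (simp add: has_field_derivative_def)
  then show "dir_deriv w f x = f' w"
    unfolding dir_deriv_def by (rule DERIV_imp_deriv)
qed

lemma real_polynomial_function_derivative:
  assumes "real_polynomial_function f"
  obtains f' where "\<And>x. (f has_derivative f' x) (at x)"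
proof -
  have "\<forall>x. \<exists>f'. (f has_derivative f') (at x)"
    using differentiable_at_real_polynomial_function[OF assms] by (simp add: differentiable_def)
  then show thesis
    using that by metis
qed

lemma has_derivative_dir_deriv:
  fixes f :: "'a::euclidean_space \<Rightarrow> real"
  assumes "real_polynomial_function f"
  shows "(f has_derivative (\<lambda>w. dir_deriv w f x)) (at x)"
  using real_polynomial_function_derivative[OF assms] dir_deriv_eq(2) by (metis ext)

lemma has_real_derivative_line:
  fixes f :: "'a::euclidean_space \<Rightarrow> real"
  assumes "real_polynomial_function f"
  shows "((\<lambda>s. f (x + s *\<^sub>R w)) has_real_derivative dir_deriv w f x) (at 0)"
  by (rule dir_deriv_eq(1)[OF has_derivative_dir_deriv[OF assms]])

lemma dir_deriv_const: "dir_deriv w (\<lambda>x. c) = (\<lambda>x. 0)"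
  using dir_deriv_eq(2)[OF has_derivative_const] by auto

lemma dir_deriv_linear: "bounded_linear f \<Longrightarrow> dir_deriv w f = (\<lambda>x. f w)"
  using dir_deriv_eq(2)[OF bounded_linear_imp_has_derivative] by auto

context
  fixes f g :: "'a::euclidean_space \<Rightarrow> real"
  assumes f: "real_polynomial_function f"
begin

lemma dir_deriv_add:
  assumes "real_polynomial_function g"
  shows "dir_deriv w (\<lambda>x. f x + g x) = (\<lambda>x. dir_deriv w f x + dir_deriv w g x)"
  using dir_deriv_eq(2)[OF has_derivative_add[OF has_derivative_dir_deriv[OF f] has_derivative_dir_deriv[OF assms]]]
  by auto

lemma dir_deriv_mult:
  assumes "real_polynomial_function g"
  shows "dir_deriv w (\<lambda>x. f x * g x) = (\<lambda>x. f x * dir_deriv w g x + dir_deriv w f x * g x)"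
  using dir_deriv_eq(2)[OF has_derivative_mult[OF has_derivative_dir_deriv[OF f] has_derivative_dir_deriv[OF assms]]]
  by auto

lemma dir_deriv_cmult: "dir_deriv w (\<lambda>x. c * f x) = (\<lambda>x. c * dir_deriv w f x)"
  using dir_deriv_eq(2)[OF has_derivative_mult_right[OF has_derivative_dir_deriv[OF f]]] by auto

lemma dir_deriv_plus_dir: "dir_deriv (u + w) f = (\<lambda>x. dir_deriv u f x + dir_deriv w f x)"
  using has_derivative_dir_deriv[OF f, THEN has_derivative_linear, THEN linear_add] by auto

lemma dir_deriv_scale_dir: "dir_deriv (c *\<^sub>R w) f = (\<lambda>x. c * dir_deriv w f x)"
  using has_derivative_dir_deriv[OF f, THEN has_derivative_linear, THEN linear_cmul] by auto

lemma dir_deriv_minus_dir: "dir_deriv (- w) f = (\<lambda>x. - dir_deriv w f x)"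
  using dir_deriv_scale_dir[of "- 1" w] by simp

lemma dir_deriv_zero_dir: "dir_deriv 0 f = (\<lambda>x. 0)"
  using dir_deriv_scale_dir[of 0 0] by simp

end

lemma real_polynomial_function_dir_deriv:
  fixes f :: "'a::euclidean_space \<Rightarrow> real"
  assumes "real_polynomial_function f"
  shows "real_polynomial_function (dir_deriv w f)"
  using assms
proof (induction rule: real_polynomial_function.induct)
  case (linear f)
  then show ?case
    by (simp add: dir_deriv_linear real_polynomial_function_const)
next
  case (const c)
  then show ?case
    by (simp add: dir_deriv_const real_polynomial_function_const)
next
  case (add f g)
  then show ?case
    using dir_deriv_add[of f g w] by (auto intro: real_polynomial_function_add)
next
  case (mult f g)
  then show ?case
    using dir_deriv_mult[of f g w]
    by (auto intro: real_polynomial_function_add real_polynomial_function_mult)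
qed

lemma dir_deriv_minus:
  fixes f :: "'a::euclidean_space \<Rightarrow> real"
  shows "real_polynomial_function f \<Longrightarrow> dir_deriv w (\<lambda>x. - f x) = (\<lambda>x. - dir_deriv w f x)"
  using dir_deriv_cmult[of f w "- 1"] by simp

lemma dir_deriv_diff:
  fixes f g :: "'a::euclidean_space \<Rightarrow> real"
  assumes "real_polynomial_function f" "real_polynomial_function g"
  shows "dir_deriv w (\<lambda>x. f x - g x) = (\<lambda>x. dir_deriv w f x - dir_deriv w g x)"
  using dir_deriv_add[OF assms(1) real_polynomial_function_minus[OF assms(2)], of w]
  by (simp add: dir_deriv_minus assms)

text \<open>For polynomials, symmetry of second derivatives follows by induction on their
  construction: in the product case the two mixed terms are exchanged.\<close>

lemma dir_deriv_commute:
  fixes f :: "'a::euclidean_space \<Rightarrow> real"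
  assumes "real_polynomial_function f"
  shows "dir_deriv u (dir_deriv w f) = dir_deriv w (dir_deriv u f)"
  using assms
proof (induction rule: real_polynomial_function.induct)
  case (linear f)
  then show ?case
    by (simp add: dir_deriv_linear dir_deriv_const)
next
  case (const c)
  then show ?case
    by (simp add: dir_deriv_const)
next
  case (add f g)
  then show ?case
    by (simp add: dir_deriv_add real_polynomial_function_dir_deriv)
next
  case (mult f g)
  note pf = mult.hyps real_polynomial_function_dir_deriv[OF mult.hyps(1)] real_polynomial_function_dir_deriv[OF mult.hyps(2)]
  show ?case
    using mult.IH
    by (simp add: dir_deriv_mult dir_deriv_add pf real_polynomial_function_mult add_ac)
qed

section \<open>Iterated directional derivatives and degree\<close>

definition dir_derivs :: "'a::real_normed_vector list \<Rightarrow> ('a \<Rightarrow> real) \<Rightarrow> 'a \<Rightarrow> real" where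
  "dir_derivs ws f = foldr dir_deriv ws f"

lemma dir_derivs_simps [simp]:
  "dir_derivs [] f = f"
  "dir_derivs (w # ws) f = dir_deriv w (dir_derivs ws f)"
  "dir_derivs (us @ ws) f = dir_derivs us (dir_derivs ws f)"
  by (auto simp: dir_derivs_def)

lemma real_polynomial_function_dir_derivs:
  fixes f :: "'a::euclidean_space \<Rightarrow> real"
  assumes "real_polynomial_function f"
  shows "real_polynomial_function (dir_derivs ws f)"
  by (induction ws) (simp_all add: assms real_polynomial_function_dir_deriv)

lemma dir_derivs_add:
  fixes f g :: "'a::euclidean_space \<Rightarrow> real"
  assumes "real_polynomial_function f" "real_polynomial_function g"
  shows "dir_derivs ws (\<lambda>x. f x + g x) = (\<lambda>x. dir_derivs ws f x + dir_derivs ws g x)"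
  by (induction ws) (simp_all add: assms dir_deriv_add real_polynomial_function_dir_derivs)

lemma dir_derivs_cmult:
  fixes f :: "'a::euclidean_space \<Rightarrow> real"
  assumes "real_polynomial_function f"
  shows "dir_derivs ws (\<lambda>x. c * f x) = (\<lambda>x. c * dir_derivs ws f x)"
  by (induction ws) (simp_all add: assms dir_deriv_cmult real_polynomial_function_dir_derivs)

lemma dir_deriv_dir_derivs:
  fixes f :: "'a::euclidean_space \<Rightarrow> real"
  assumes "real_polynomial_function f"
  shows "dir_derivs ws (dir_deriv w f) = dir_deriv w (dir_derivs ws f)"
proof (induction ws)
  case (Cons v ws)
  then show ?case
    using dir_deriv_commute[OF real_polynomial_function_dir_derivs[OF assms]] by simp
qed simp

text \<open>By commutation only the multiset of directions matters. A chosen edge direction can thus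
  be moved to the front, and a list of normals sorted to match a multi-index.\<close>

lemma dir_derivs_mset:
  fixes f :: "'a::euclidean_space \<Rightarrow> real"
  assumes f: "real_polynomial_function f" and "mset us = mset ws"
  shows "dir_derivs us f = dir_derivs ws f"
  using assms(2)
proof (induction us arbitrary: ws)
  case (Cons u us)
  then have "u \<in> set ws"
    by (metis list.set_intros(1) set_mset_mset)
  then obtain xs ys where ws: "ws = xs @ u # ys"
    by (meson split_list)
  with Cons.prems have "mset us = mset (xs @ ys)"
    by simp
  then have "dir_derivs us f = dir_derivs (xs @ ys) f"
    by (rule Cons.IH)
  then show ?case
    using dir_deriv_dir_derivs[OF real_polynomial_function_dir_derivs[OF f, of ys], of xs u] by (simp add: ws)
qed simp

text \<open>A coordinate-free degree bound: all directional derivatives of order \<open>k\<close>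
  vanish. With the strict bound the zero function sits at level 0, and each differentiation lowers
  the level by exactly one.\<close>

primrec deg_less :: "nat \<Rightarrow> ('a::real_normed_vector \<Rightarrow> real) \<Rightarrow> bool" where
  "deg_less 0 f \<longleftrightarrow> f = (\<lambda>x. 0)"
| "deg_less (Suc k) f \<longleftrightarrow> real_polynomial_function f \<and> (\<forall>w. deg_less k (dir_deriv w f))"

lemma deg_less_imp_polynomial: "deg_less k f \<Longrightarrow> real_polynomial_function f"
  by (cases k) (auto simp: real_polynomial_function_const)

lemma deg_less_zero: "deg_less k (\<lambda>x. 0)"
  by (induction k) (simp_all add: dir_deriv_const real_polynomial_function_const)

lemma deg_less_Suc: "deg_less k f \<Longrightarrow> deg_less (Suc k) f"
proof (induction k arbitrary: f)
  case (Suc k)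
  then show ?case
    by auto
qed (simp add: dir_deriv_const real_polynomial_function_const)

lemma deg_less_mono: "j \<le> k \<Longrightarrow> deg_less j f \<Longrightarrow> deg_less k f"
  by (induction k rule: dec_induct) (auto intro: deg_less_Suc simp del: deg_less.simps)

lemma deg_less_add:
  fixes f g :: "'a::euclidean_space \<Rightarrow> real"
  shows "deg_less k f \<Longrightarrow> deg_less k g \<Longrightarrow> deg_less k (\<lambda>x. f x + g x)"
  by (induction k arbitrary: f g) (auto simp: dir_deriv_add intro: real_polynomial_function_add)

lemma deg_less_cmult:
  fixes f :: "'a::euclidean_space \<Rightarrow> real"
  shows "deg_less k f \<Longrightarrow> deg_less k (\<lambda>x. c * f x)"
  by (induction k arbitrary: f) (auto simp: dir_deriv_cmult)

text \<open>Factors of degree at most \<open>j\<close> and \<open>k\<close> are differentiated by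
  the product rule, and induction on \<open>j + k\<close> applies to both terms. A factor at level
  \<open>Suc 0\<close> has zero derivative, which removes the term where the induction hypothesis
  cannot be applied.\<close>

lemma deg_less_mult:
  fixes f g :: "'a::euclidean_space \<Rightarrow> real"
  assumes "deg_less (Suc j) f" "deg_less (Suc k) g"
  shows "deg_less (Suc (j + k)) (\<lambda>x. f x * g x)"
  using assms
proof (induction "j + k" arbitrary: j k f g rule: less_induct)
  case less
  have pf: "real_polynomial_function f" "real_polynomial_function g"
    using less.prems by auto
  have "deg_less (j + k) (\<lambda>x. f x * dir_deriv w g x)" for w
  proof (cases k)
    case 0
    then show ?thesis
      using less.prems(2) by (simp add: deg_less_zero)
  next
    case (Suc k')
    then show ?thesis
      using less.hyps[of j k' f "dir_deriv w g"] less.prems by simp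
  qed
  moreover have "deg_less (j + k) (\<lambda>x. dir_deriv w f x * g x)" for w
  proof (cases j)
    case 0
    then show ?thesis
      using less.prems(1) by (simp add: deg_less_zero)
  next
    case (Suc j')
    then show ?thesis
      using less.hyps[of j' k "dir_deriv w f" g] less.prems by simp
  qed
  ultimately show ?case
    using pf by (simp add: dir_deriv_mult real_polynomial_function_mult deg_less_add)
qed

lemma deg_less_const: "deg_less (Suc k) (\<lambda>x. c)"
  by (simp add: dir_deriv_const real_polynomial_function_const deg_less_zero)

lemma deg_less_linear: "bounded_linear f \<Longrightarrow> deg_less (Suc (Suc k)) f"
  by (auto simp: dir_deriv_linear dir_deriv_const intro: real_polynomial_function.intros deg_less_zero)

lemma deg_less_power:
  fixes f :: "'a::euclidean_space \<Rightarrow> real"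
  assumes "deg_less 2 f"
  shows "deg_less (Suc k) (\<lambda>x. f x ^ k)"
proof (induction k)
  case (Suc k)
  have "deg_less (Suc 1) f"
    using assms by (simp add: eval_nat_numeral del: deg_less.simps)
  then show ?case
    using deg_less_mult[of 1 f k "\<lambda>x. f x ^ k"] Suc by simp
qed (simp add: dir_deriv_const real_polynomial_function_const)

lemma deg_less_prod:
  fixes f :: "'i \<Rightarrow> 'a::euclidean_space \<Rightarrow> real"
  assumes "finite A" "\<And>i. i \<in> A \<Longrightarrow> deg_less (Suc (m i)) (f i)"
  shows "deg_less (Suc (\<Sum>i\<in>A. m i)) (\<lambda>x. \<Prod>i\<in>A. f i x)"
  using assms
proof (induction rule: finite_induct)
  case (insert a A)
  have "deg_less (Suc (m a + (\<Sum>i\<in>A. m i))) (\<lambda>x. f a x * (\<Prod>i\<in>A. f i x))"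
    by (rule deg_less_mult) (use insert in \<open>auto simp del: deg_less.simps\<close>)
  then show ?case
    using insert by (simp del: deg_less.simps)
qed (simp add: dir_deriv_const real_polynomial_function_const)

lemma deg_less_1_imp_const:
  fixes f :: "'a::euclidean_space \<Rightarrow> real"
  assumes "deg_less 1 f"
  obtains c where "f = (\<lambda>x. c)"
proof -
  have "\<exists>c. \<forall>x\<in>UNIV. f x = c"
  proof (rule has_derivative_zero_constant)
    fix x
    show "(f has_derivative (\<lambda>h. 0)) (at x within UNIV)"
      using has_derivative_dir_deriv[of f x] assms by simp
  qed auto
  then show thesis
    using that by auto
qed

lemma deg_less_dir_derivs:
  "deg_less (k + length ws) f \<Longrightarrow> deg_less k (dir_derivs ws f)"
proof (induction ws arbitrary: k)
  case (Cons w ws)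
  then have "deg_less (Suc k) (dir_derivs ws f)"
    by (simp del: deg_less.simps)
  then show ?case
    by simp
qed simp

text \<open>Unfolds the recursion of \<open>deg_less\<close>: its successive directions, read from
  the last entry of the list to the first, are the directions in \<open>ws\<close>.\<close>

lemma deg_lessI:
  fixes f :: "'a::euclidean_space \<Rightarrow> real"
  assumes "real_polynomial_function f" "\<And>ws. length ws = k \<Longrightarrow> dir_derivs ws f = (\<lambda>x. 0)"
  shows "deg_less k f"
  using assms
proof (induction k arbitrary: f)
  case (Suc k)
  have "dir_derivs ws (dir_deriv w f) = (\<lambda>x. 0)" if "length ws = k" for ws w
    using Suc.prems(2)[of "ws @ [w]"] that by simp
  then show ?case
    using Suc by (simp add: real_polynomial_function_dir_deriv)
qed simp

lemma deg_less_polys_upto: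
  fixes p :: "real^'n \<Rightarrow> real"
  assumes "p \<in> polys_upto k"
  shows "deg_less (Suc k) p"
proof -
  have mono: "deg_less (Suc k) (\<lambda>x::real^'n. \<Prod>i\<in>UNIV. (x $ i) ^ m i)" if "(\<Sum>i\<in>UNIV. m i) \<le> k" for m
  proof -
    have "deg_less 2 (\<lambda>x::real^'n. x $ i)" for i
      using deg_less_linear[of "\<lambda>x::real^'n. x $ i" 0] by (simp add: bounded_linear_vec_nth eval_nat_numeral del: deg_less.simps)
    then have "deg_less (Suc (\<Sum>i\<in>UNIV. m i)) (\<lambda>x::real^'n. \<Prod>i\<in>UNIV. (x $ i) ^ m i)"
      by (intro deg_less_prod deg_less_power) auto
    then show ?thesis
      using that deg_less_mono by blast
  qed
  show ?thesis
    using assms unfolding polys_upto_def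
  proof (induction rule: fun_space.span_induct_alt)
    case base
    then show ?case
      using deg_less_zero[of "Suc k"] by (simp add: zero_fun_def)
  next
    case (step c x y)
    then show ?case
      using deg_less_add[OF deg_less_cmult[OF mono, of _ c] step(2)]
      by (force simp: plus_fun_def simp del: deg_less.simps)
  qed
qed

section \<open>Means of derivatives over faces\<close>

lemma real_polynomial_function_continuous:
  fixes f :: "'a::euclidean_space \<Rightarrow> real"
  shows "real_polynomial_function f \<Longrightarrow> continuous_on UNIV f"
  using continuous_on_polymonial_function real_polynomial_function_eq by blast

lemma simplex_integral_dir_deriv:
  fixes a b :: "'a::euclidean_space"
  assumes "finite J" "a \<notin> J" "real_polynomial_function f"
  shows "simplex_integral (insert a J) b (dir_deriv (a - b) f) = simplex_integral J a f - simplex_integral J b f"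
  using assms
  by (intro simplex_integral_derivative real_polynomial_function_continuous real_polynomial_function_dir_deriv
      has_real_derivative_line)

text \<open>By the divergence theorem the integral of a derivative along the edge from
  \<open>b\<close> to \<open>a\<close> is a difference of integrals over the facets opposite
  \<open>b\<close> and \<open>a\<close>, and these are multiples of the facet means.\<close>

lemma face_mean_edge_deriv:
  fixes S :: "'a::euclidean_space set"
  assumes S: "\<not> affine_dependent S" and ab: "a \<in> S" "b \<in> S" "a \<noteq> b" and f: "real_polynomial_function f"
    and facets: "face_mean (convex hull (S - {a})) f = 0" "face_mean (convex hull (S - {b})) f = 0"
  shows "face_mean (convex hull S) (dir_deriv (a - b) f) = 0"
proof -
  let ?J = "S - {a, b}"
  have fin: "finite ?J"
    using aff_independent_finite[OF S] by simp
  have sub: "\<not> affine_dependent (S - {a})" "\<not> affine_dependent (S - {b})"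
    using S affine_independent_subset by blast+
  have J: "S - {a} - {b} = ?J" "S - {b} - {a} = ?J" "S - {b} = insert a ?J"
    using ab by auto
  have cf: "continuous_on UNIV f" "continuous_on UNIV (dir_deriv (a - b) f)"
    using f by (intro real_polynomial_function_continuous real_polynomial_function_dir_deriv; simp)+
  have "simplex_integral ?J b f = 0"
    using face_mean_simplex[OF sub(1) _ cf(1), of b] ab facets by (simp add: J(1))
  moreover have "simplex_integral ?J a f = 0"
    using face_mean_simplex[OF sub(2) _ cf(1), of a] ab facets by (simp add: J(2))
  moreover have "face_mean (convex hull S) (dir_deriv (a - b) f) =
      fact (card (insert a ?J)) * simplex_integral (insert a ?J) b (dir_deriv (a - b) f)"
    by (rule face_mean_simplex[OF S ab(2) cf(2), unfolded J(3)])
  ultimately show ?thesis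
    using simplex_integral_dir_deriv[OF fin _ f, of a b] by simp
qed

text \<open>Restricting to polynomials settles integrability once and for all; additivity and
  homogeneity are what \<open>dir_derivs_multilinear\<close> asks of its functional.\<close>

lemma face_mean_linear:
  fixes S :: "'a::euclidean_space set"
  assumes S: "\<not> affine_dependent S" "S \<noteq> {}"
  shows "\<And>f g. real_polynomial_function f \<Longrightarrow> real_polynomial_function g \<Longrightarrow>
      face_mean (convex hull S) (\<lambda>x. f x + g x) = face_mean (convex hull S) f + face_mean (convex hull S) g"
    and "\<And>c f. real_polynomial_function f \<Longrightarrow>
      face_mean (convex hull S) (\<lambda>x. c * f x) = c * face_mean (convex hull S) f"
    and "\<And>c. face_mean (convex hull S) (\<lambda>x. c) = c"
proof -
  obtain b where b: "b \<in> S"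
    using S by blast
  have fin: "finite S"
    using aff_independent_finite[OF S(1)] .
  note mean = face_mean_simplex[OF S(1) b]
  show "face_mean (convex hull S) (\<lambda>x. f x + g x) = face_mean (convex hull S) f + face_mean (convex hull S) g"
    if "real_polynomial_function f" "real_polynomial_function g" for f g
    using that[THEN real_polynomial_function_continuous]
    by (simp add: mean continuous_on_add simplex_integral_add fin distrib_left)
  show "face_mean (convex hull S) (\<lambda>x. c * f x) = c * face_mean (convex hull S) f"
    if "real_polynomial_function f" for c f
    using that[THEN real_polynomial_function_continuous]
    by (simp add: mean continuous_on_mult_left simplex_integral_cmult)
  show "face_mean (convex hull S) (\<lambda>x. c) = c" for c
    by (simp add: mean simplex_integral_const fin)
qed

text \<open>An iterated derivative is linear in each direction, so a linear functional needs to be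
  tested only on directions from a spanning set.\<close>

lemma dir_derivs_multilinear:
  fixes f :: "'a::euclidean_space \<Rightarrow> real" and L :: "('a \<Rightarrow> real) \<Rightarrow> real"
  assumes f: "real_polynomial_function f"
    and add: "\<And>f g. real_polynomial_function f \<Longrightarrow> real_polynomial_function g \<Longrightarrow> L (\<lambda>x. f x + g x) = L f + L g"
    and scale: "\<And>c f. real_polynomial_function f \<Longrightarrow> L (\<lambda>x. c * f x) = c * L f"
    and G: "span G = UNIV"
    and zero: "\<And>ws. length ws = s \<Longrightarrow> set ws \<subseteq> G \<Longrightarrow> L (dir_derivs ws f) = 0"
    and len: "length ws = s"
  shows "L (dir_derivs ws f) = 0"
proof -
  \<comment> \<open>The directions are expanded from the last to the first: those in
    \<open>ws\<close> already lie in \<open>G\<close>, those in \<open>us\<close> are still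
    arbitrary.\<close>
  have "L (dir_derivs (us @ ws) f) = 0" if "length us + length ws = s" "set ws \<subseteq> G" for us ws
    using that
  proof (induction us arbitrary: ws rule: rev_induct)
    case Nil
    then show ?case
      using zero by simp
  next
    case (snoc u us)
    note pf = real_polynomial_function_dir_derivs[OF f]
    have "u \<in> span G"
      using G by simp
    then have "L (dir_derivs (us @ u # ws) f) = 0"
    proof (induction rule: span_induct_alt)
      case base
      have "L (\<lambda>x. 0) = 0"
        using scale[OF f, of 0] by simp
      moreover have "dir_derivs us (\<lambda>x. 0) = (\<lambda>x. 0)"
        by (induction us) (simp_all add: dir_deriv_const)
      ultimately show ?case
        by (simp add: dir_deriv_zero_dir[OF pf])
    next
      case (step c x y)
      have "L (dir_derivs (us @ x # ws) f) = 0"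
        using snoc.IH[of "x # ws"] snoc.prems step(1) by simp
      then show ?case
        using step(2)
        by (simp add: dir_deriv_plus_dir dir_deriv_scale_dir dir_derivs_add dir_derivs_cmult add scale pf
            real_polynomial_function_dir_deriv real_polynomial_function_dir_derivs real_polynomial_function_mult
            real_polynomial_function_const)
    qed
    then show ?case
      by simp
  qed
  from this[of ws "[]"] show ?thesis
    using len by simp
qed

text \<open>A multi-index is read as the multiplicities of a list of indices, so that a list of
  normal directions can be recognised as a degree of freedom.\<close>

lemma mixed_deriv_count_list:
  fixes f :: "'a::euclidean_space \<Rightarrow> real"
  assumes f: "real_polynomial_function f" and js: "set js \<subseteq> {1..k}"
  shows "mixed_deriv w k (count_list js) f = dir_derivs (map w js) f"
proof -
  have pow: "(dir_deriv u ^^ m) g = dir_derivs (replicate m u) g" for u m and g :: "'a \<Rightarrow> real"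
    by (induction m) simp_all
  have "foldr (\<lambda>i. dir_deriv (w i) ^^ \<alpha> i) ks f = dir_derivs (map w (concat (map (\<lambda>i. replicate (\<alpha> i) i) ks))) f"
    for \<alpha> ks
    by (induction ks) (simp_all add: pow)
  then have "mixed_deriv w k (count_list js) f =
      dir_derivs (map w (concat (map (\<lambda>i. replicate (count_list js i) i) [1..<Suc k]))) f"
    by (simp only: mixed_deriv_def)
  also have "\<dots> = dir_derivs (map w js) f"
  proof (rule dir_derivs_mset[OF f])
    \<comment> \<open>For a general \<open>ks\<close> the blocks collect exactly the entries of
      \<open>js\<close> that occur in \<open>ks\<close>; distinctness prevents double
      counting.\<close>
    have "mset (concat (map (\<lambda>i. replicate (count_list js i) i) ks)) = filter_mset (\<lambda>i. i \<in> set ks) (mset js)"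
      if "distinct ks" for ks
      using that
    proof (induction ks)
      case (Cons i ks)
      have "mset (replicate (count_list js i) i) = filter_mset (\<lambda>l. l = i) (mset js)"
        by (simp add: filter_eq_replicate_mset count_mset)
      then show ?case
        using Cons by (auto intro!: multiset_eqI)
    qed simp
    then have "mset (concat (map (\<lambda>i. replicate (count_list js i) i) [1..<Suc k])) =
        filter_mset (\<lambda>i. i \<in> set [1..<Suc k]) (mset js)"
      using distinct_upt by blast
    also have "\<dots> = mset js"
      using js by (intro multiset_eqI) (auto simp flip: not_in_iff)
    finally have "mset (concat (map (\<lambda>i. replicate (count_list js i) i) [1..<Suc k])) = mset js" .
    then show "mset (map w (concat (map (\<lambda>i. replicate (count_list js i) i) [1..<Suc k]))) = mset (map w js)"
      by (simp only: mset_map)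
  qed
  finally show ?thesis .
qed

section \<open>Injectivity of the degrees of freedom\<close>

locale framed_simplex =
  fixes V :: "(real^'n) set" and \<nu> :: "(real^'n) set \<Rightarrow> nat \<Rightarrow> real^'n"
  assumes aff: "\<not> affine_dependent V" and card_V: "card V = CARD('n) + 1"
    and frame: "normal_frame (convex hull V) \<nu>"
begin

lemma finite_V: "finite V"
  by (rule aff_independent_finite[OF aff])

lemma vertices_hull: "vertices (convex hull V) = V"
  using extreme_point_of_convex_hull_affine_independent[OF aff] by (auto simp: vertices_def)

lemma sub_independent: "S \<subseteq> V \<Longrightarrow> \<not> affine_dependent S"
  using aff affine_independent_subset by blast

lemma face_in_faces_codim:
  assumes "S \<subseteq> V" "S \<noteq> {}"
  shows "convex hull S \<in> faces_codim (convex hull V) (CARD('n) + 1 - card S)"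
proof -
  have "card S \<le> CARD('n) + 1" "card S > 0"
    using assms card_mono[OF finite_V] finite_subset[OF _ finite_V] by (auto simp: card_V card_gt_0_iff)
  then have "card S = CARD('n) - (CARD('n) + 1 - card S) + 1"
    by simp
  then show ?thesis
    using assms(1) unfolding faces_codim_def vertices_hull by blast
qed

text \<open>The normals are orthogonal to the edges, so the two spans meet only in zero, and their
  dimensions \<open>card S - 1\<close> and \<open>CARD('n) + 1 - card S\<close> add up to
  \<open>CARD('n)\<close>. For \<open>S = V\<close> there are no normals and the edges alone
  span.\<close>

lemma span_edges_normals:
  assumes S: "S \<subseteq> V" and b: "b \<in> S"
  shows "span ((\<lambda>j. j - b) ` (S - {b}) \<union> \<nu> (convex hull S) ` {1..CARD('n) + 1 - card S}) = UNIV"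
proof -
  let ?E = "(\<lambda>j. j - b) ` (S - {b})" and ?F = "convex hull S" and ?k = "CARD('n) + 1 - card S"
  let ?N = "\<nu> ?F ` {1..?k}"
  note E = edge_independent[OF sub_independent[OF S] b]
  have cS: "card S \<le> CARD('n) + 1" "card S > 0"
    using S b card_mono[OF finite_V S] finite_subset[OF S finite_V] by (auto simp: card_V card_gt_0_iff)
  have N: "orthogonal (\<nu> ?F i) t" if "i \<in> {1..?k}" "t \<in> span ?E" for i t
  proof -
    have "?k \<in> {1..CARD('n)}"
      using that cS by auto
    then show ?thesis
      using frame face_in_faces_codim[OF S] that tangent_space_simplex(1)[OF b] b unfolding normal_frame_def by blast
  qed
  have indN: "inj_on (\<nu> ?F) {1..?k} \<and> independent ?N"
  \<comment> \<open>\<open>normal_frame\<close> speaks only of codimension at least 1; in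
    codimension 0 the family of normals is empty.\<close>
  proof (cases "?k = 0")
    case False
    then have "?k \<in> {1..CARD('n)}"
      using cS by auto
    then show ?thesis
      using frame face_in_faces_codim[OF S] b unfolding normal_frame_def by blast
  qed (simp add: independent_empty)
  have dimE: "dim ?E = card S - 1"
    using E dim_eq_card_independent[OF E(3)] by (simp add: card_image b)
  have dimN: "dim ?N = ?k"
    using indN dim_eq_card_independent[of ?N] by (simp add: card_image)
  have "span ?E \<inter> span ?N \<subseteq> {0}"
  proof
    fix x assume x: "x \<in> span ?E \<inter> span ?N"
    have "orthogonal x y" if "y \<in> ?N" for y
      using N x that by (auto simp: orthogonal_commute)
    then have "orthogonal x x"
      using x orthogonal_to_span by blast
    then show "x \<in> {0}"
      by (simp add: orthogonal_self)
  qed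
  then have "span ?E \<inter> span ?N = {0}"
    using span_zero by blast
  then have "dim {x + y | x y. x \<in> span ?E \<and> y \<in> span ?N} = card S - 1 + ?k"
    using dim_sums_Int[OF subspace_span subspace_span, of ?E ?N]
    unfolding dim_span dimE dimN by simp
  also have "\<dots> = DIM(real^'n)"
    using cS by simp
  finally have full: "span {x + y | x y. x \<in> span ?E \<and> y \<in> span ?N} = UNIV"
    by (simp only: dim_eq_full)
  have "{x + y | x y. x \<in> span ?E \<and> y \<in> span ?N} \<subseteq> span (?E \<union> ?N)"
    using span_mono[of ?E "?E \<union> ?N"] span_mono[of ?N "?E \<union> ?N"] by (auto intro!: span_add)
  from span_minimal[OF this subspace_span] show ?thesis
    unfolding full by blast
qed

text \<open>Induction on the number of vertices. By multilinearity each direction may be taken to be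
  an edge at \<open>b\<close> or a normal. With normals only, the mean is a degree of freedom; with
  at least one edge, integrating along it leaves derivatives of one order less on two facets with
  one vertex less.\<close>

lemma face_means_vanish:
  assumes v: "real_polynomial_function v" and dofs: "\<forall>i\<in>dof_indices (convex hull V). dof \<nu> i v = 0"
    and S: "S \<subseteq> V" "S \<noteq> {}" and len: "length ws = card S"
  shows "face_mean (convex hull S) (dir_derivs ws v) = 0"
  using S len
proof (induction "card S" arbitrary: S ws rule: less_induct)
  case less
  note S = less.prems(1,2)
  obtain b where b: "b \<in> S"
    using S by blast
  have fin: "finite S"
    using S finite_subset finite_V by blast
  have cS: "card S \<le> CARD('n) + 1" "card S > 0"
    using S fin card_mono[OF finite_V S(1)] by (auto simp: card_V card_gt_0_iff)
  note aS = sub_independent[OF S(1)]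
  let ?E = "(\<lambda>j. j - b) ` (S - {b})" and ?F = "convex hull S" and ?k = "CARD('n) + 1 - card S"
  let ?N = "\<nu> ?F ` {1..?k}"
  show ?case
  proof (rule dir_derivs_multilinear[where L="face_mean ?F" and s="card S" and G="?E \<union> ?N"])
    show "span (?E \<union> ?N) = UNIV"
      by (rule span_edges_normals[OF S(1) b])
    fix ws assume ws: "length ws = card S" "set ws \<subseteq> ?E \<union> ?N"
    show "face_mean ?F (dir_derivs ws v) = 0"
    proof (cases "set ws \<subseteq> ?N")
      case True
      then have "ws \<in> lists (\<nu> ?F ` {1..?k})"
        by auto
      then have "ws \<in> map (\<nu> ?F) ` lists {1..?k}"
        by (simp only: lists_image)
      then obtain js where js: "set js \<subseteq> {1..?k}" "ws = map (\<nu> ?F) js"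
        by (auto simp: lists_eq_set)
      \<comment> \<open>At least one normal occurs, so the codimension is positive: the full
        simplex, which carries no degrees of freedom, is excluded.\<close>
      have "js \<noteq> []"
        using ws(1) js(2) cS by auto
      then have "{1..?k} \<noteq> {}"
        using js(1) by (cases js) auto
      then have k: "1 \<le> ?k" "?k \<le> CARD('n)"
        using cS by auto
      have zero: "count_list js i = 0" if "i \<notin> {1..?k}" for i
        using js(1) that by (auto simp: count_list_0_iff)
      have "(\<Sum>i=1..CARD('n). count_list js i) = (\<Sum>i\<in>set js. count_list js i)"
        using js(1) k(2) by (intro sum.mono_neutral_right) (auto simp: count_list_0_iff)
      \<comment> \<open>The order matches because a face of codimension \<open>k\<close> has
        \<open>CARD('n) + 1 - k\<close> vertices.\<close>
      also have "\<dots> = CARD('n) + 1 - ?k"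
        using ws(1) js(2) cS by (simp add: sum_count_set)
      finally have "Face_Dof ?k ?F (count_list js) \<in> dof_indices (convex hull V)"
        using k zero face_in_faces_codim[OF S] unfolding dof_indices_def multi_indices_def by force
      then have "dof \<nu> (Face_Dof ?k ?F (count_list js)) v = 0"
        using dofs by blast
      then show ?thesis
        using mixed_deriv_count_list[OF v js(1), of "\<nu> ?F"] js(2) by simp
    next
      case False
      then obtain a where a: "a \<in> S" "a \<noteq> b" "a - b \<in> set ws"
        using ws(2) by blast
      then obtain us where us: "mset ws = mset ((a - b) # us)"
        by (metis insert_DiffM mset.simps(2) ex_mset set_mset_mset)
      have lus: "length us = card S - 1"
        using ws(1) mset_eq_length[OF us] by simp
      have facet: "face_mean (convex hull (S - {c})) (dir_derivs us v) = 0" if "c \<in> S" for c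
      proof (rule less.hyps)
        show "card (S - {c}) < card S"
          using fin that by (metis card_Diff1_less)
        show "S - {c} \<noteq> {}"
          using a b by blast
        show "length us = card (S - {c})"
          using fin that lus by simp
      qed (use S in blast)
      have "face_mean ?F (dir_deriv (a - b) (dir_derivs us v)) = 0"
        by (rule face_mean_edge_deriv[OF aS a(1) b a(2) real_polynomial_function_dir_derivs[OF v] facet[OF a(1)] facet[OF b]])
      then show ?thesis
        using dir_derivs_mset[OF v us] by simp
    qed
  qed (use v less.prems(3) face_mean_linear[OF aS S(2)] in auto)
qed

text \<open>The error formula of Kergin interpolation. Adding a node \<open>a\<close> changes the
  integral by a multiple of the mean, over the hull of the nodes used so far, of a derivative of
  \<open>v\<close> whose order is the number of these nodes. Such means vanish by assumption, so
  only the remainder is left.\<close>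

lemma kergin:
  assumes v: "real_polynomial_function v"
    and means: "\<And>S ws. S \<subseteq> V \<Longrightarrow> S \<noteq> {} \<Longrightarrow> length ws = card S \<Longrightarrow> face_mean (convex hull S) (dir_derivs ws v) = 0"
    and "distinct as" "set as \<subseteq> V"
  shows "dir_deriv t v x = simplex_integral (set as) x (dir_derivs (map (\<lambda>a. x - a) as) (dir_deriv t v))"
  using assms(3,4)
proof (induction as)
  case Nil
  then show ?case
    by (simp add: simplex_integral_empty)
next
  case (Cons a as)
  let ?h = "dir_derivs (map (\<lambda>a. x - a) as) (dir_deriv t v)" and ?S = "insert a (set as)"
  have pf: "real_polynomial_function ?h"
    by (intro real_polynomial_function_dir_derivs real_polynomial_function_dir_deriv v)
  have S: "?S \<subseteq> V" "?S - {a} = set as"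
    using Cons.prems by auto
  \<comment> \<open>The direction \<open>t\<close> supplies the one derivative beyond
    \<open>length as\<close>, so that the order equals the number of vertices.\<close>
  have "face_mean (convex hull ?S) (dir_derivs (map (\<lambda>a. x - a) as @ [t]) v) = 0"
    using Cons.prems S by (intro means) (auto simp: distinct_card)
  then have "simplex_integral (set as) a ?h = 0"
    using face_mean_simplex[OF sub_independent[OF S(1)] insertI1 real_polynomial_function_continuous[OF pf]] S(2)
    by simp
  moreover have "simplex_integral ?S x (dir_deriv (a - x) ?h) = simplex_integral (set as) a ?h - simplex_integral (set as) x ?h"
    using Cons.prems pf by (intro simplex_integral_dir_deriv) auto
  \<comment> \<open>The recursion differentiates along \<open>a - x\<close>, the expansion along
    \<open>x - a\<close>; this sign turns the difference of integrals into the next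
    remainder.\<close>
  moreover have "dir_deriv (a - x) ?h = (\<lambda>y. (- 1) * dir_deriv (x - a) ?h y)"
    using dir_deriv_minus_dir[OF pf, of "x - a"] by simp
  ultimately have "simplex_integral (set as) x ?h = simplex_integral ?S x (dir_deriv (x - a) ?h)"
    by (simp only: simplex_integral_cmult)
  then show ?case
    using Cons by simp
qed

section \<open>Barycentric coordinates and derivatives of the bubble function\<close>

abbreviation bary :: "real^'n \<Rightarrow> real^'n \<Rightarrow> real" where
  "bary \<equiv> barycentric (convex hull V)"

text \<open>The condition under the definite description in \<open>barycentric\<close>. Vanishing
  outside \<open>V\<close> is what makes the coordinates unique as a function.\<close>

definition is_coords :: "real^'n \<Rightarrow> (real^'n \<Rightarrow> real) \<Rightarrow> bool" where
  "is_coords x u \<longleftrightarrow> (\<forall>b. b \<notin> V \<longrightarrow> u b = 0) \<and> (\<Sum>b\<in>V. u b) = 1 \<and> (\<Sum>b\<in>V. u b *\<^sub>R b) = x"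

lemma is_coords_unique:
  assumes "is_coords x u" "is_coords x w"
  shows "u = w"
proof -
  have "(\<Sum>b\<in>V. u b - w b) = 0" "(\<Sum>b\<in>V. (u b - w b) *\<^sub>R b) = 0"
    using assms by (simp_all add: is_coords_def sum_subtractf scaleR_diff_left)
  then have "u b - w b = 0" if "b \<in> V" for b
    using aff that unfolding affine_dependent_explicit_finite[OF finite_V] by blast
  then show ?thesis
    using assms by (force simp: is_coords_def)
qed

lemma barycentric_eqI: "is_coords x u \<Longrightarrow> bary a x = u a"
  unfolding barycentric_def vertices_hull is_coords_def[symmetric]
  using is_coords_unique by (metis the_equality)

lemma is_coords_barycentric: "is_coords x (\<lambda>a. bary a x)"
proof -
  have "x \<in> affine hull V"
    using affine_independent_span_eq[OF aff] card_V by simp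
  then obtain u where u: "sum u V = 1" "(\<Sum>b\<in>V. u b *\<^sub>R b) = x"
    unfolding affine_hull_finite[OF finite_V] by blast
  have "is_coords x (\<lambda>b. if b \<in> V then u b else 0)"
    using u by (simp add: is_coords_def cong: sum.cong)
  moreover from this have "(\<lambda>a. bary a x) = (\<lambda>b. if b \<in> V then u b else 0)"
    using barycentric_eqI by blast
  ultimately show ?thesis
    by simp
qed

lemma barycentric_vertex:
  assumes "a \<in> V" "c \<in> V"
  shows "bary a c = (if a = c then 1 else 0)"
proof (rule barycentric_eqI)
  show "is_coords c (\<lambda>a. if a = c then 1 else 0)"
    using assms finite_V
    by (simp add: is_coords_def if_distrib[of "\<lambda>c. c *\<^sub>R _"] cong: if_cong)
qed

text \<open>The coefficients 1, \<open>s\<close> and \<open>- s\<close> sum to 1, so the same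
  combination of the three coordinate vectors has total weight 1 and represents the new
  point.\<close>

lemma barycentric_affine: "bary a (x + s *\<^sub>R (y - z)) = bary a x + s * (bary a y - bary a z)"
proof (rule barycentric_eqI)
  show "is_coords (x + s *\<^sub>R (y - z)) (\<lambda>a. bary a x + s * (bary a y - bary a z))"
    using is_coords_barycentric[of x] is_coords_barycentric[of y] is_coords_barycentric[of z]
    by (simp add: is_coords_def sum.distrib sum_subtractf algebra_simps flip: sum_distrib_left scaleR_scaleR scaleR_right.sum)
qed

lemma barycentric_linear: "linear (\<lambda>w. bary a w - bary a 0)"
proof (rule linearI)
  show "bary a (x + y) - bary a 0 = (bary a x - bary a 0) + (bary a y - bary a 0)" for x y
    using barycentric_affine[of a x 1 y 0] by simp
  show "bary a (c *\<^sub>R x) - bary a 0 = c *\<^sub>R (bary a x - bary a 0)" for c x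
    using barycentric_affine[of a 0 c x 0] by simp
qed

lemma deg_less_barycentric: "deg_less 2 (bary a)"
proof -
  have "deg_less 2 (\<lambda>w. (bary a w - bary a 0) + bary a 0)"
  proof (rule deg_less_add)
    show "deg_less 2 (\<lambda>w. bary a w - bary a 0)"
      using deg_less_linear[OF linear_conv_bounded_linear[THEN iffD1, OF barycentric_linear], of 0 a]
      by (simp add: numeral_2_eq_2 del: deg_less.simps)
    show "deg_less 2 (\<lambda>w::real^'n. bary a 0)"
      using deg_less_const[of 1] by (simp add: numeral_2_eq_2 del: deg_less.simps)
  qed
  then show ?thesis
    by simp
qed

lemmas pf_barycentric = deg_less_imp_polynomial[OF deg_less_barycentric]

lemma dir_deriv_barycentric: "dir_deriv (y - z) (bary a) = (\<lambda>x. bary a y - bary a z)"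
proof
  fix x
  have "((\<lambda>s. bary a (x + s *\<^sub>R (y - z))) has_real_derivative (bary a y - bary a z)) (at 0)"
    unfolding barycentric_affine by (auto intro!: derivative_eq_intros)
  then show "dir_deriv (y - z) (bary a) x = bary a y - bary a z"
    unfolding dir_deriv_def by (rule DERIV_imp_deriv)
qed

lemma deg_less_bubble: "deg_less (CARD('n) + 2) (bubble (convex hull V))"
proof -
  have "deg_less (Suc (\<Sum>a\<in>V. 1)) (\<lambda>x. \<Prod>a\<in>V. bary a x)"
    by (rule deg_less_prod[OF finite_V]) (use deg_less_barycentric in \<open>simp add: numeral_2_eq_2 del: deg_less.simps\<close>)
  moreover have "bubble (convex hull V) = (\<lambda>x. \<Prod>a\<in>V. bary a x)"
    by (simp add: bubble_def vertices_hull fun_eq_iff)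
  ultimately show ?thesis
    by (simp add: card_V del: deg_less.simps)
qed

lemma pf_prod_barycentric: "finite R \<Longrightarrow> real_polynomial_function (\<lambda>y. \<Prod>m\<in>R. bary m y)"
  by (intro real_polynomial_function_prod pf_barycentric)

lemma dir_deriv_prod_barycentric_zero:
  assumes "finite R" "\<And>m. m \<in> R \<Longrightarrow> bary m y = bary m z"
  shows "dir_deriv (y - z) (\<lambda>x. \<Prod>m\<in>R. bary m x) = (\<lambda>x. 0)"
  using assms
  by (induction rule: finite_induct)
    (simp_all add: dir_deriv_const dir_deriv_mult pf_barycentric pf_prod_barycentric dir_deriv_barycentric)

text \<open>Along \<open>x - a\<close> the coordinate of \<open>a\<close> changes at rate -1, while
  those of the other vertices in \<open>R\<close> are constant because they vanish at both
  \<open>x\<close> and \<open>a\<close>. Each derivative therefore strips one factor and leaves a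
  sign.\<close>

lemma dir_derivs_prod_barycentric:
  assumes "distinct R" "set R \<subseteq> V" "\<And>m. m \<in> set R \<Longrightarrow> bary m x = 0"
  shows "dir_derivs (map (\<lambda>a. x - a) R) (\<lambda>y. \<Prod>m\<in>set R. bary m y) = (\<lambda>y. (- 1) ^ length R)"
  using assms
proof (induction R)
  case (Cons a R)
  let ?Q = "\<lambda>y. \<Prod>m\<in>set R. bary m y"
  have pf: "real_polynomial_function (\<lambda>y. bary a y * ?Q y)" "real_polynomial_function ?Q"
    by (intro real_polynomial_function_mult pf_barycentric pf_prod_barycentric; simp)+
  have Q: "dir_deriv (x - a) ?Q = (\<lambda>y. 0)"
    by (rule dir_deriv_prod_barycentric_zero) (use Cons.prems barycentric_vertex[of _ a] in auto)
  have a: "dir_deriv (x - a) (bary a) = (\<lambda>y. - 1)"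
    using Cons.prems barycentric_vertex[of a a] by (simp add: dir_deriv_barycentric)
  have "dir_derivs (map (\<lambda>a. x - a) (a # R)) (\<lambda>y. \<Prod>m\<in>set (a # R). bary m y) =
      dir_deriv (x - a) (dir_derivs (map (\<lambda>a. x - a) R) (\<lambda>y. bary a y * ?Q y))"
    using Cons.prems by simp
  also have "\<dots> = dir_derivs (map (\<lambda>a. x - a) R) (dir_deriv (x - a) (\<lambda>y. bary a y * ?Q y))"
    by (rule dir_deriv_dir_derivs[OF pf(1), symmetric])
  also have "dir_deriv (x - a) (\<lambda>y. bary a y * ?Q y) = (\<lambda>y. (- 1) * ?Q y)"
    by (simp add: dir_deriv_mult pf_barycentric pf a Q)
  also have "dir_derivs (map (\<lambda>a. x - a) R) \<dots> = (\<lambda>y. (- 1) * (- 1) ^ length R)"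
    unfolding dir_derivs_cmult[OF pf(2)] using Cons by simp
  finally show ?case
    by simp
qed simp

text \<open>Along \<open>i - j\<close> the coordinates of \<open>i\<close> and \<open>j\<close>
  change at rates 1 and -1, \<open>r\<close> at rate \<open>\<rho>\<close>, and all other
  coordinates are constant. So the function is cubic along the line with leading coefficient
  \<open>- \<rho>\<close> times the product of the others, and the factor 6 is 3!.\<close>

lemma third_deriv_bubble:
  assumes ij: "i \<in> V" "j \<in> V" "i \<noteq> j"
    and r: "real_polynomial_function r" "dir_deriv (i - j) r = (\<lambda>x. \<rho>)"
  shows "dir_derivs [i - j, i - j, i - j] (\<lambda>x. bubble (convex hull V) x * r x) =
    (\<lambda>x. (- 6 * \<rho>) * (\<Prod>m\<in>V - {i, j}. bary m x))"
proof -
  let ?D = "dir_deriv (i - j)" and ?Q = "\<lambda>x. \<Prod>m\<in>V - {i, j}. bary m x"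
  have Q: "real_polynomial_function ?Q" "?D ?Q = (\<lambda>x. 0)"
    using ij finite_V barycentric_vertex
    by (simp add: pf_prod_barycentric, intro dir_deriv_prod_barycentric_zero) auto
  have DQ: "?D (\<lambda>x. f x * ?Q x) = (\<lambda>x. ?D f x * ?Q x)" if "real_polynomial_function f" for f
    using that Q by (simp add: dir_deriv_mult)
  have i: "?D (bary i) = (\<lambda>x. 1)" and j: "?D (bary j) = (\<lambda>x. - 1)"
    using ij by (simp_all add: dir_deriv_barycentric barycentric_vertex)
  let ?f = "\<lambda>x. bary i x * (bary j x * r x)"
  note pf = pf_barycentric r(1) real_polynomial_function_mult real_polynomial_function_add real_polynomial_function_const
  have "(\<lambda>x. bubble (convex hull V) x * r x) = (\<lambda>x. ?f x * ?Q x)"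
  proof
    fix x
    have "(\<Prod>m\<in>V. bary m x) = bary i x * (bary j x * ?Q x)"
      using ij finite_V prod.remove[of V i "\<lambda>m. bary m x"] prod.remove[of "V - {i}" j "\<lambda>m. bary m x"]
      by (simp add: Diff_insert2[symmetric] insert_commute)
    then show "bubble (convex hull V) x * r x = ?f x * ?Q x"
      by (simp add: bubble_def vertices_hull)
  qed
  moreover have f: "real_polynomial_function ?f"
    by (intro pf)
  moreover have "?D (?D (?D ?f)) = (\<lambda>x. - 6 * \<rho>)"
    by (simp add: dir_deriv_mult dir_deriv_add dir_deriv_minus dir_deriv_diff dir_deriv_const i j r(2) pf
        real_polynomial_function_minus real_polynomial_function_diff)
  ultimately show ?thesis
    by (simp add: DQ real_polynomial_function_dir_deriv)
qed

text \<open>The list has \<open>CARD('n) + 2\<close> directions and so annihilates \<open>p\<close>.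
  On the bubble part, the three edge derivatives leave the product over the other vertices, which
  the directions \<open>x - a\<close> reduce to a sign.\<close>

lemma top_deriv:
  assumes ij: "i \<in> V" "j \<in> V" "i \<noteq> j" and R: "distinct R" "set R = V - {i, j}"
    and p: "deg_less (CARD('n) + 2) p"
    and r: "real_polynomial_function r" "dir_deriv (i - j) r = (\<lambda>x. \<rho>)"
    and x: "\<And>m. m \<in> V - {i, j} \<Longrightarrow> bary m x = 0"
  shows "dir_derivs (map (\<lambda>a. x - a) R @ [i - j, i - j, i - j]) (\<lambda>x. p x + bubble (convex hull V) x * r x) =
    (\<lambda>y. - 6 * \<rho> * (- 1) ^ length R)"
proof -
  let ?ws = "map (\<lambda>a. x - a) R @ [i - j, i - j, i - j]"
  have "card {i, j} = 2"
    using ij by simp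
  then have "length R + 2 = CARD('n) + 1"
    using R ij card_Diff_subset[of "{i, j}" V] card_mono[OF finite_V, of "{i, j}"] card_V
    by (simp add: distinct_card[symmetric])
  then have "deg_less 0 (dir_derivs ?ws p)"
    using p by (intro deg_less_dir_derivs) (simp del: deg_less.simps)
  then have "dir_derivs ?ws p = (\<lambda>x. 0)"
    by simp
  moreover have "dir_derivs ?ws (\<lambda>x. bubble (convex hull V) x * r x) = (\<lambda>y. - 6 * \<rho> * (- 1) ^ length R)"
  proof -
    have "dir_derivs ?ws (\<lambda>x. bubble (convex hull V) x * r x) =
        dir_derivs (map (\<lambda>a. x - a) R) (\<lambda>x. (- 6 * \<rho>) * (\<Prod>m\<in>set R. bary m x))"
      unfolding dir_derivs_simps(3) third_deriv_bubble[OF ij r] R(2) ..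
    also have "\<dots> = (\<lambda>y. (- 6 * \<rho>) * dir_derivs (map (\<lambda>a. x - a) R) (\<lambda>y. \<Prod>m\<in>set R. bary m y) y)"
      by (rule dir_derivs_cmult[OF pf_prod_barycentric]) simp
    also have "\<dots> = (\<lambda>y. (- 6 * \<rho>) * (- 1) ^ length R)"
      using R x by (subst dir_derivs_prod_barycentric) auto
    finally show ?thesis .
  qed
  moreover have "real_polynomial_function (\<lambda>x. bubble (convex hull V) x * r x)"
    using deg_less_imp_polynomial[OF deg_less_bubble] r(1) by (rule real_polynomial_function_mult)
  ultimately show ?thesis
    using dir_derivs_add[OF deg_less_imp_polynomial[OF p], of _ ?ws] by simp
qed

section \<open>Vanishing of the bubble part and descent in degree\<close>

lemma dir_deriv_zeroI:
  assumes r: "real_polynomial_function r" and zero: "\<And>i j. i \<in> V \<Longrightarrow> j \<in> V \<Longrightarrow> i \<noteq> j \<Longrightarrow> dir_deriv (i - j) r = (\<lambda>x. 0)"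
  shows "dir_deriv w r = (\<lambda>x. 0)"
proof -
  obtain b where b: "b \<in> V"
    using card_V by (metis Suc_eq_plus1 card.empty ex_in_conv nat.distinct(1))
  have "span ((\<lambda>j. j - b) ` (V - {b})) = UNIV"
    using span_edges_normals[OF subset_refl b] by (simp add: card_V)
  then have "w \<in> span ((\<lambda>j. j - b) ` (V - {b}))"
    by simp
  then show ?thesis
  proof (induction rule: span_induct_alt)
    case base
    then show ?case
      by (rule dir_deriv_zero_dir[OF r])
  next
    case (step c x y)
    then show ?case
      using zero b by (auto simp: dir_deriv_plus_dir[OF r] dir_deriv_scale_dir[OF r])
  qed
qed

text \<open>The Kergin expansion of the derivative along the edge from \<open>j\<close> to \<open>i\<close> leaves only its last term,
  the multiple \<open>\<tau> (\<tau> - 1)\<close> of a constant; Rolle's theorem makes that constant zero.\<close>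

lemma bubble_part_edge_zero:
  assumes ij: "i \<in> V" "j \<in> V" "i \<noteq> j"
    and p: "deg_less (CARD('n) + 2) p"
    and r: "real_polynomial_function r" "dir_deriv (i - j) r = (\<lambda>x. \<rho>)"
    and v: "v = (\<lambda>x. p x + bubble (convex hull V) x * r x)"
    and means: "\<And>S ws. S \<subseteq> V \<Longrightarrow> S \<noteq> {} \<Longrightarrow> length ws = card S \<Longrightarrow> face_mean (convex hull S) (dir_derivs ws v) = 0"
    and ends: "v i = v j"
  shows "\<rho> = 0"
proof -
  let ?D = "dir_deriv (i - j)"
  have pf: "real_polynomial_function v"
    unfolding v using deg_less_imp_polynomial[OF deg_less_bubble] deg_less_imp_polynomial[OF p] r(1)
    by (intro real_polynomial_function_add real_polynomial_function_mult)
  have line: "((\<lambda>\<tau>. v (j + \<tau> *\<^sub>R (i - j))) has_real_derivative ?D v (j + \<tau> *\<^sub>R (i - j))) (at \<tau>)" for \<tau>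
  proof -
    have "((\<lambda>s. v (j + \<tau> *\<^sub>R (i - j) + s *\<^sub>R (i - j))) has_real_derivative ?D v (j + \<tau> *\<^sub>R (i - j))) (at 0)"
      by (rule has_real_derivative_line[OF pf])
    then have "((\<lambda>s. v (j + (s + \<tau>) *\<^sub>R (i - j))) has_real_derivative ?D v (j + \<tau> *\<^sub>R (i - j))) (at 0)"
      by (simp add: algebra_simps)
    then show ?thesis
      using DERIV_shift[of "\<lambda>\<tau>. v (j + \<tau> *\<^sub>R (i - j))" _ 0 \<tau>] by simp
  qed
  have "\<exists>\<tau>>0. \<tau> < 1 \<and> ((\<lambda>\<tau>. v (j + \<tau> *\<^sub>R (i - j))) has_real_derivative 0) (at \<tau>)"
  proof (rule Rolle)
    show "continuous_on {0..1} (\<lambda>\<tau>. v (j + \<tau> *\<^sub>R (i - j)))"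
      using line by (intro continuous_at_imp_continuous_on) (blast intro: DERIV_isCont)
  qed (use line ends in \<open>auto simp: real_differentiable_def\<close>)
  then obtain \<tau> where \<tau>: "0 < \<tau>" "\<tau> < 1" "((\<lambda>\<tau>. v (j + \<tau> *\<^sub>R (i - j))) has_real_derivative 0) (at \<tau>)"
    by blast
  define x where "x = j + \<tau> *\<^sub>R (i - j)"
  have Dv: "?D v x = 0"
    using DERIV_unique[OF line \<tau>(3)] by (simp add: x_def)
  \<comment> \<open>For the two ends of the edge the Kergin directions are multiples of the edge
    direction, so they join the derivative being expanded to give three edge derivatives; the factor
    \<open>(\<tau> - 1) * \<tau>\<close> is nonzero inside the edge.\<close>
  have xi: "x - i = (\<tau> - 1) *\<^sub>R (i - j)" and xj: "x - j = \<tau> *\<^sub>R (i - j)"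
    by (simp_all add: x_def algebra_simps)
  obtain R where R: "distinct R" "set R = V - {i, j}"
    using finite_distinct_list[of "V - {i, j}"] finite_V by blast
  \<comment> \<open>On the edge all coordinates except those of \<open>i\<close> and
    \<open>j\<close> vanish, which is the hypothesis of \<open>top_deriv\<close>.\<close>
  have coord: "bary m x = 0" if "m \<in> V - {i, j}" for m
    using that ij by (simp add: x_def barycentric_affine barycentric_vertex)
  let ?c = "- 6 * \<rho> * (- 1) ^ length R"
  have VR: "set (R @ [i, j]) = V" "distinct (R @ [i, j])"
    using R ij by auto
  note pfD = real_polynomial_function_dir_deriv[OF pf] real_polynomial_function_dir_deriv[OF real_polynomial_function_dir_deriv[OF pf]]
    real_polynomial_function_dir_deriv[OF real_polynomial_function_dir_deriv[OF real_polynomial_function_dir_deriv[OF pf]]]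
  have "dir_derivs (map (\<lambda>a. x - a) (R @ [i, j])) (?D v) =
      dir_derivs (map (\<lambda>a. x - a) R) (\<lambda>y. ((\<tau> - 1) * \<tau>) * ?D (?D (?D v)) y)"
  proof -
    have 1: "dir_deriv (x - j) (?D v) = (\<lambda>y. \<tau> * ?D (?D v) y)"
      unfolding xj by (rule dir_deriv_scale_dir[OF pfD(1)])
    have 2: "dir_deriv (x - i) (\<lambda>y. \<tau> * ?D (?D v) y) = (\<lambda>y. (\<tau> - 1) * (\<tau> * ?D (?D (?D v)) y))"
      unfolding xi dir_deriv_cmult[OF pfD(2)] dir_deriv_scale_dir[OF pfD(2)] by (simp add: mult.left_commute)
    show ?thesis
      by (simp only: map_append list.map dir_derivs_simps 1 2 mult.assoc)
  qed
  also have "\<dots> = (\<lambda>y. ((\<tau> - 1) * \<tau>) * dir_derivs (map (\<lambda>a. x - a) R @ [i - j, i - j, i - j]) v y)"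
    unfolding dir_derivs_cmult[OF pfD(3)] by simp
  also have "\<dots> = (\<lambda>y. ((\<tau> - 1) * \<tau>) * ?c)"
    unfolding v using top_deriv[OF ij R p r coord] by simp
  finally have expand: "dir_derivs (map (\<lambda>a. x - a) (R @ [i, j])) (?D v) = (\<lambda>y. ((\<tau> - 1) * \<tau>) * ?c)" .
  have "?D v x = simplex_integral V x (\<lambda>y. ((\<tau> - 1) * \<tau>) * ?c)"
    using kergin[OF pf means VR(2) equalityD1[OF VR(1)], of "i - j" x] unfolding VR(1) expand .
  also have "\<dots> = ((\<tau> - 1) * \<tau>) * ?c / fact (card V)"
    by (rule simplex_integral_const[OF finite_V])
  finally show ?thesis
    using Dv \<tau> by simp
qed

text \<open>If all derivatives of order \<open>k + 1\<close> vanish, those of order \<open>k\<close>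
  are constants, hence equal to their means over any face with \<open>k\<close> vertices, which are
  zero.\<close>

lemma deg_less_descend:
  assumes v: "deg_less (CARD('n) + 2) v"
    and means: "\<And>S ws. S \<subseteq> V \<Longrightarrow> S \<noteq> {} \<Longrightarrow> length ws = card S \<Longrightarrow> face_mean (convex hull S) (dir_derivs ws v) = 0"
    and k: "1 \<le> k" "k \<le> CARD('n) + 2"
  shows "deg_less k v"
  using k(2,1)
proof (induction k rule: inc_induct)
  case base
  show ?case
    by (rule v)
next
  case (step k)
  show ?case
  proof (rule deg_lessI)
    show "real_polynomial_function v"
      by (rule deg_less_imp_polynomial[OF v])
    fix ws :: "(real^'n) list" assume ws: "length ws = k"
    \<comment> \<open>Here \<open>k\<close> is at most \<open>CARD('n) + 1\<close>, the number of
      vertices, so such a subset exists.\<close>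
    obtain S where S: "S \<subseteq> V" "card S = k"
      using obtain_subset_with_card_n[of k V] step card_V by auto
    have "deg_less 1 (dir_derivs ws v)"
      using step ws by (intro deg_less_dir_derivs) (simp del: deg_less.simps)
    then obtain c where c: "dir_derivs ws v = (\<lambda>x. c)"
      by (rule deg_less_1_imp_const)
    have "S \<noteq> {}"
      using S step by auto
    then have "c = 0"
      using means[of S ws] S ws face_mean_linear(3)[OF sub_independent[OF S(1)], of c] by (simp add: c)
    then show "dir_derivs ws v = (\<lambda>x. 0)"
      by (simp add: c)
  qed
qed

lemma dofs_injective:
  assumes v: "v \<in> shape_space (convex hull V)" and dofs: "\<forall>i\<in>dof_indices (convex hull V). dof \<nu> i v = 0"
  shows "v = (\<lambda>x. 0)"
proof -
  obtain p r where pr: "v = (\<lambda>x. p x + bubble (convex hull V) x * r x)"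
    "p \<in> polys_upto (CARD('n) + 1)" "r \<in> polys_upto 1"
    using v unfolding shape_space_def by blast
  have p: "deg_less (CARD('n) + 2) p" and r: "deg_less 2 r"
    using deg_less_polys_upto[OF pr(2)] deg_less_polys_upto[OF pr(3)] by (simp_all add: numeral_2_eq_2 del: deg_less.simps)
  note pf_r = deg_less_imp_polynomial[OF r]
  have pf: "real_polynomial_function v"
    unfolding pr(1) using deg_less_imp_polynomial[OF deg_less_bubble] deg_less_imp_polynomial[OF p] pf_r
    by (intro real_polynomial_function_add real_polynomial_function_mult)
  note means = face_means_vanish[OF pf dofs]
  have vert: "v a = 0" if "a \<in> V" for a
  proof -
    have "Vertex_Dof a \<in> dof_indices (convex hull V)"
      using that by (simp add: dof_indices_def vertices_hull)
    then have "dof \<nu> (Vertex_Dof a) v = 0"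
      using dofs by blast
    then show ?thesis
      by simp
  qed
  have "dir_deriv (i - j) r = (\<lambda>x. 0)" if ij: "i \<in> V" "j \<in> V" "i \<noteq> j" for i j
  proof -
    \<comment> \<open>Since \<open>r\<close> has degree at most 1, its derivative along the edge is
      a single constant, as the edge lemma requires.\<close>
    have "deg_less 1 (dir_deriv (i - j) r)"
      using r by (simp add: numeral_2_eq_2)
    then obtain \<rho> where \<rho>: "dir_deriv (i - j) r = (\<lambda>x. \<rho>)"
      by (rule deg_less_1_imp_const)
    have "\<rho> = 0"
      by (rule bubble_part_edge_zero[OF ij p pf_r \<rho> pr(1) means]) (use ij vert in auto)
    then show ?thesis
      by (simp add: \<rho>)
  qed
  then have "deg_less 1 r"
    using pf_r dir_deriv_zeroI by simp
  then obtain c where c: "r = (\<lambda>x. c)"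
    by (rule deg_less_1_imp_const)
  \<comment> \<open>With \<open>r\<close> constant the bubble part is a multiple of a product of
    \<open>CARD('n) + 1\<close> affine functions, so it no longer exceeds the degree of
    \<open>p\<close>.\<close>
  have "deg_less (CARD('n) + 2) v"
    unfolding pr(1) c using deg_less_add[OF p deg_less_cmult[OF deg_less_bubble, of c]] by (simp add: mult.commute del: deg_less.simps)
  then have "deg_less 1 v"
    by (rule deg_less_descend[OF _ means]) auto
  then obtain d where d: "v = (\<lambda>x. d)"
    by (rule deg_less_1_imp_const)
  obtain b where "b \<in> V"
    using card_V by (metis Suc_eq_plus1 card.empty ex_in_conv nat.distinct(1))
  then show ?thesis
    using vert d by auto
qed

end

section \<open>Dimension count\<close>

definition exponents_le :: "'i set \<Rightarrow> nat \<Rightarrow> ('i \<Rightarrow> nat) set" where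
  "exponents_le A k = {f. (\<forall>i. i \<notin> A \<longrightarrow> f i = 0) \<and> (\<Sum>i\<in>A. f i) \<le> k}"

text \<open>Pascal's rule: an exponent either vanishes at \<open>a\<close>, or arises from a unique
  one of total at most one less by raising its entry at \<open>a\<close>.\<close>

lemma card_exponents_le:
  fixes A :: "'i set"
  assumes "finite A"
  shows "finite (exponents_le A k) \<and> card (exponents_le A k) = (card A + k) choose k"
  using assms
proof (induction arbitrary: k rule: finite_induct)
  case empty
  have "exponents_le ({} :: 'i set) k = {\<lambda>_. 0}"
    by (auto simp: exponents_le_def)
  then show ?case
    by simp
next
  case (insert a A)
  show ?case
  proof (induction k)
    case 0
    have "f = (\<lambda>_. 0)" if f: "f \<in> exponents_le (insert a A) 0" for f
    proof
      fix i
      show "f i = 0"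
        using f insert.hyps by (cases "i \<in> insert a A") (auto simp: exponents_le_def)
    qed
    then have "exponents_le (insert a A) 0 = {\<lambda>_. 0}"
      by (auto simp: exponents_le_def)
    then show ?case
      by simp
  next
    case (Suc k)
    let ?up = "\<lambda>f. f(a := Suc (f a))"
    have sum_upd: "(\<Sum>i\<in>A. (f(a := y)) i) = (\<Sum>i\<in>A. f i)" for f :: "'i \<Rightarrow> nat" and y
      using insert.hyps by (intro sum.cong) auto
    have "exponents_le (insert a A) (Suc k) = exponents_le A (Suc k) \<union> ?up ` exponents_le (insert a A) k" (is "?L = ?R")
    proof
      show "?L \<subseteq> ?R"
      proof
        fix f assume f: "f \<in> ?L"
        show "f \<in> ?R"
        proof (cases "f a")
          case 0
          have "f i = 0" if "i \<notin> A" for i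
            using f 0 that by (cases "i = a") (auto simp: exponents_le_def)
          then have "f \<in> exponents_le A (Suc k)"
            using f insert.hyps 0 by (simp add: exponents_le_def)
          then show ?thesis ..
        next
          case (Suc m)
          have "f = ?up (f(a := m))"
            using Suc by auto
          moreover have "f(a := m) \<in> exponents_le (insert a A) k"
            using f insert.hyps Suc sum_upd[of f m] by (auto simp: exponents_le_def)
          ultimately show ?thesis
            by blast
        qed
      qed
      show "?R \<subseteq> ?L"
      proof (intro Un_least image_subsetI)
        show "exponents_le A (Suc k) \<subseteq> ?L"
          using insert.hyps by (auto simp: exponents_le_def)
        fix f assume "f \<in> exponents_le (insert a A) k"
        then show "?up f \<in> ?L"
          using insert.hyps sum_upd[of f "Suc (f a)"] by (simp add: exponents_le_def)
      qed
    qed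
    moreover have "exponents_le A (Suc k) \<inter> ?up ` exponents_le (insert a A) k = {}"
      using insert.hyps by (auto simp: exponents_le_def)
    moreover have "inj ?up"
    proof (rule injI)
      fix f g :: "'i \<Rightarrow> nat" assume eq: "?up f = ?up g"
      show "f = g"
      proof
        fix i
        show "f i = g i"
          using fun_cong[OF eq, of i] by (cases "i = a") auto
      qed
    qed
    ultimately show ?case
      using insert.IH[of "Suc k"] Suc.IH insert.hyps
      by (simp add: card_Un_disjoint card_image inj_on_subset[of ?up UNIV])
  qed
qed

text \<open>The entry at \<open>a\<close> serves as a slack variable: it is determined by the other
  entries, whose sum is only bounded by \<open>k\<close>.\<close>

lemma card_exponents_eq:
  assumes "finite A" "a \<notin> A"
  shows "finite {f. (\<forall>i. i \<notin> insert a A \<longrightarrow> f i = 0) \<and> (\<Sum>i\<in>insert a A. f i) = k}"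
    and "card {f. (\<forall>i. i \<notin> insert a A \<longrightarrow> f i = 0) \<and> (\<Sum>i\<in>insert a A. f i) = k} = (card A + k) choose k"
proof -
  let ?E = "{f. (\<forall>i. i \<notin> insert a A \<longrightarrow> f i = 0) \<and> (\<Sum>i\<in>insert a A. f i) = k}"
  have sum_upd: "(\<Sum>i\<in>A. (f(a := y)) i) = (\<Sum>i\<in>A. f i)" for f :: "'a \<Rightarrow> nat" and y
    using assms by (intro sum.cong) auto
  have "bij_betw (\<lambda>f. f(a := 0)) ?E (exponents_le A k)"
  proof (rule bij_betw_byWitness[where f'="\<lambda>g. g(a := k - (\<Sum>i\<in>A. g i))"])
    show "\<forall>f\<in>?E. (f(a := 0))(a := k - (\<Sum>i\<in>A. (f(a := 0)) i)) = f"
      using assms by (auto simp: sum_upd simp del: fun_upd_apply intro!: fun_upd_idem)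
    show "\<forall>g\<in>exponents_le A k. (g(a := k - (\<Sum>i\<in>A. g i)))(a := 0) = g"
      using assms by (auto simp: exponents_le_def)
    show "(\<lambda>f. f(a := 0)) ` ?E \<subseteq> exponents_le A k"
      using assms by (auto simp: exponents_le_def sum_upd simp del: fun_upd_apply) auto
    show "(\<lambda>g. g(a := k - (\<Sum>i\<in>A. g i))) ` exponents_le A k \<subseteq> ?E"
      using assms by (auto simp: exponents_le_def sum_upd simp del: fun_upd_apply) auto
  qed
  from bij_betw_finite[OF this] bij_betw_same_card[OF this]
  show "finite ?E" "card ?E = (card A + k) choose k"
    using card_exponents_le[OF assms(1), of k] by simp_all
qed

text \<open>Induction on the variables. Grouped by the exponent of the variable \<open>a\<close>,
  the sum is a polynomial in one real variable that vanishes identically, so each of its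
  coefficients, a polynomial in the remaining variables, vanishes too.\<close>

lemma monomials_independent:
  fixes c :: "('i \<Rightarrow> nat) \<Rightarrow> real"
  assumes "finite A" "finite N" "\<And>m i. m \<in> N \<Longrightarrow> i \<notin> A \<Longrightarrow> m i = 0"
    and "\<And>x. (\<Sum>m\<in>N. c m * (\<Prod>i\<in>A. x i ^ m i)) = 0"
  shows "\<forall>m\<in>N. c m = 0"
  using assms
proof (induction arbitrary: N c rule: finite_induct)
  case empty
  have "m = (\<lambda>_. 0)" if "m \<in> N" for m
    using empty.prems(2)[OF that] by auto
  then have "N = {} \<or> N = {\<lambda>_. 0}"
    by blast
  then show ?case
    using empty.prems(3) by auto
next
  case (insert a A)
  have "c m = 0" if m: "m \<in> N" for m
  proof -
    let ?N = "\<lambda>j. {m \<in> N. m a = j}" and ?j = "m a"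
    define K where "K = Max ((\<lambda>m. m a) ` N)"
    have K: "m a \<le> K" if "m \<in> N" for m
      using that insert.prems(1) by (simp add: K_def)
    have "(\<Sum>m\<in>?N j. c m * (\<Prod>i\<in>A. x i ^ m i)) = 0" if "j \<le> K" for x j
    proof -
      have "(\<Sum>j\<le>K. (\<Sum>m\<in>?N j. c m * (\<Prod>i\<in>A. x i ^ m i)) * t ^ j) = 0" for t
      proof -
        have "(\<Sum>j\<le>K. (\<Sum>m\<in>?N j. c m * (\<Prod>i\<in>A. x i ^ m i)) * t ^ j) =
            (\<Sum>j\<le>K. \<Sum>m\<in>?N j. c m * (\<Prod>i\<in>A. x i ^ m i) * t ^ m a)"
          by (simp add: sum_distrib_right)
        also have "\<dots> = (\<Sum>m\<in>N. c m * (\<Prod>i\<in>A. x i ^ m i) * t ^ m a)"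
          using K insert.prems(1) by (intro sum.group) auto
        also have "\<dots> = (\<Sum>m\<in>N. c m * (\<Prod>i\<in>insert a A. (x(a := t)) i ^ m i))"
        proof (rule sum.cong[OF refl])
          fix m
          have "(\<Prod>i\<in>A. (x(a := t)) i ^ m i) = (\<Prod>i\<in>A. x i ^ m i)"
            using insert.hyps by (intro prod.cong) auto
          then show "c m * (\<Prod>i\<in>A. x i ^ m i) * t ^ m a = c m * (\<Prod>i\<in>insert a A. (x(a := t)) i ^ m i)"
            using insert.hyps by simp
        qed
        also have "\<dots> = 0"
          by (rule insert.prems(3))
        finally show ?thesis .
      qed
      then show ?thesis
        using polyfun_eq_0[of "\<lambda>j. \<Sum>m\<in>?N j. c m * (\<Prod>i\<in>A. x i ^ m i)" K] that by blast
    qed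
    then have zero: "(\<Sum>m\<in>?N ?j. c m * (\<Prod>i\<in>A. x i ^ m i)) = 0" for x
      using K[OF m] by blast
    \<comment> \<open>Within one group the entry at \<open>a\<close> is fixed, so erasing it is
      injective; the induction hypothesis needs exponents that vanish outside
      \<open>A\<close>.\<close>
    let ?f = "\<lambda>m. m(a := 0)" and ?c = "\<lambda>m. c (m(a := ?j))"
    have inj: "inj_on ?f (?N ?j)"
      by (rule inj_on_inverseI[where g="\<lambda>m. m(a := ?j)"]) auto
    have "\<forall>m\<in>?f ` ?N ?j. ?c m = 0"
    proof (rule insert.IH)
      fix x
      have "(\<Sum>m\<in>?f ` ?N ?j. ?c m * (\<Prod>i\<in>A. x i ^ m i)) = (\<Sum>m'\<in>?N ?j. ?c (?f m') * (\<Prod>i\<in>A. x i ^ (?f m') i))"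
        by (rule sum.reindex[OF inj, unfolded comp_def])
      also have "\<dots> = (\<Sum>m\<in>?N ?j. c m * (\<Prod>i\<in>A. x i ^ m i))"
      proof (rule sum.cong[OF refl])
        fix m' assume "m' \<in> ?N ?j"
        then have "m'(a := 0, a := ?j) = m'"
          by auto
        moreover have "(\<Prod>i\<in>A. x i ^ (?f m') i) = (\<Prod>i\<in>A. x i ^ m' i)"
          using insert.hyps by (intro prod.cong) auto
        ultimately show "?c (?f m') * (\<Prod>i\<in>A. x i ^ (?f m') i) = c m' * (\<Prod>i\<in>A. x i ^ m' i)"
          by simp
      qed
      finally show "(\<Sum>m\<in>?f ` ?N ?j. ?c m * (\<Prod>i\<in>A. x i ^ m i)) = 0"
        using zero by simp
    qed (use insert.prems in auto)
    then have "?c (?f m) = 0"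
      using m by blast
    then show ?thesis
      by simp
  qed
  then show ?case
    by blast
qed

text \<open>Turns a statement about coefficients of an indexed family into injectivity and
  independence of its image, as needed to read off a dimension.\<close>

lemma fun_space_independent_image:
  fixes \<phi> :: "'i \<Rightarrow> 'a \<Rightarrow> real"
  assumes I: "finite I" and lin: "\<And>c. (\<And>x. (\<Sum>i\<in>I. c i * \<phi> i x) = 0) \<Longrightarrow> \<forall>i\<in>I. c i = 0"
  shows "inj_on \<phi> I" "fun_space.independent (\<phi> ` I)"
proof -
  show inj: "inj_on \<phi> I"
  proof (rule inj_onI, rule ccontr)
    fix i j assume ij: "i \<in> I" "j \<in> I" "\<phi> i = \<phi> j" "i \<noteq> j"
    \<comment> \<open>If two members coincide, their difference is a nontrivial relation.\<close>
    let ?c = "\<lambda>l. (if l = i then 1 else 0) - (if l = j then 1 else 0) :: real"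
    have "(\<Sum>l\<in>I. ?c l * \<phi> l x) = 0" for x
    proof -
      have "(\<Sum>l\<in>I. ?c l * \<phi> l x) = (\<Sum>l\<in>I. if l = i then \<phi> l x else 0) - (\<Sum>l\<in>I. if l = j then \<phi> l x else 0)"
        unfolding sum_subtractf[symmetric] by (intro sum.cong) auto
      then show ?thesis
        using ij I by simp
    qed
    from lin[OF this] ij show False
      by auto
  qed
  show "fun_space.independent (\<phi> ` I)"
  proof
    assume "fun_space.dependent (\<phi> ` I)"
    then obtain u v where u: "v \<in> \<phi> ` I" "u v \<noteq> 0" "(\<Sum>v\<in>\<phi> ` I. (\<lambda>x. u v * v x)) = 0"
      using fun_space.dependent_finite[of "\<phi> ` I"] I by auto
    have "(\<Sum>i\<in>I. u (\<phi> i) * \<phi> i x) = 0" for x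
    proof -
      have sum_apply: "(\<Sum>v\<in>B. g v) x = (\<Sum>v\<in>B. g v x)" if "finite B" for B and g :: "('a \<Rightarrow> real) \<Rightarrow> 'a \<Rightarrow> real"
        using that by (induction rule: finite_induct) auto
      have "(\<Sum>i\<in>I. u (\<phi> i) * \<phi> i x) = (\<Sum>v\<in>\<phi> ` I. u v * v x)"
        using inj by (simp add: sum.reindex)
      also have "\<dots> = (\<Sum>v\<in>\<phi> ` I. (\<lambda>x. u v * v x)) x"
        using I by (simp add: sum_apply)
      finally show ?thesis
        by (simp add: u(3))
    qed
    from lin[OF this] u show False
      by auto
  qed
qed

section \<open>Arithmetic of the polynomial spaces\<close>

definition monomial :: "('n \<Rightarrow> nat) \<Rightarrow> real^'n \<Rightarrow> real" where
  "monomial m x = (\<Prod>i\<in>UNIV. (x $ i) ^ m i)"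

lemma polys_upto_monomials: "polys_upto k = fun_space.span (monomial ` exponents_le UNIV k)"
  unfolding polys_upto_def exponents_le_def by (rule arg_cong[where f=fun_space.span]) (auto simp: monomial_def fun_eq_iff image_iff)

lemma polys_upto_add: "p \<in> polys_upto k \<Longrightarrow> q \<in> polys_upto k \<Longrightarrow> (\<lambda>x. p x + q x) \<in> polys_upto k"
  using fun_space.span_add[of p _ q] by (simp add: polys_upto_def plus_fun_def)

lemma polys_upto_cmult: "p \<in> polys_upto k \<Longrightarrow> (\<lambda>x. c * p x) \<in> polys_upto k"
  using fun_space.span_scale[of p] by (simp add: polys_upto_def)

lemma polys_upto_zero: "(\<lambda>x. 0) \<in> polys_upto k"
  using fun_space.span_zero by (simp add: polys_upto_def zero_fun_def)

lemma polys_upto_sum: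
  "finite A \<Longrightarrow> (\<And>i. i \<in> A \<Longrightarrow> f i \<in> polys_upto k) \<Longrightarrow> (\<lambda>x. \<Sum>i\<in>A. f i x) \<in> polys_upto k"
  by (induction rule: finite_induct) (simp_all add: polys_upto_zero polys_upto_add)

lemma monomial_in_polys_upto: "(\<Sum>i\<in>UNIV. m i) \<le> k \<Longrightarrow> monomial m \<in> polys_upto k"
  unfolding polys_upto_monomials by (rule fun_space.span_base) (auto simp: exponents_le_def)

lemma monomial_zero: "monomial (\<lambda>_. 0) x = 1"
  by (simp add: monomial_def)

lemma monomial_single: "monomial (\<lambda>j. if j = i then 1 else 0) x = x $ i"
  by (simp add: monomial_def if_distrib[of "\<lambda>m. _ ^ m"] cong: if_cong)

lemma monomial_mult: "monomial m x * monomial l x = monomial (\<lambda>i. m i + l i) x"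
  by (simp add: monomial_def power_add prod.distrib)

lemma polys_upto_const: "(\<lambda>x. c) \<in> polys_upto k"
  using polys_upto_cmult[OF monomial_in_polys_upto[of "\<lambda>_. 0" k], of c] by (simp add: monomial_zero)

lemma polys_upto_coordinate: "(\<lambda>x. x $ i) \<in> polys_upto 1"
proof -
  have "monomial (\<lambda>j. if j = i then 1 else 0) = (\<lambda>x. x $ i)"
    by (rule ext) (rule monomial_single)
  then show ?thesis
    using monomial_in_polys_upto[of "\<lambda>j. if j = i then 1 else 0" 1] by simp
qed

text \<open>The product is bilinear, so two nested inductions over the spans reduce it to monomials,
  whose exponents add.\<close>

lemma polys_upto_mult:
  fixes p q :: "real^'n \<Rightarrow> real"
  assumes p: "p \<in> polys_upto j" and q: "q \<in> polys_upto k"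
  shows "(\<lambda>x. p x * q x) \<in> polys_upto (j + k)"
  using p unfolding polys_upto_monomials[of j]
proof (induction rule: fun_space.span_induct_alt)
  case base
  then show ?case
    by (simp add: polys_upto_zero)
next
  case (step c f g)
  then obtain m where m: "f = monomial m" "(\<Sum>i\<in>UNIV. m i) \<le> j"
    by (auto simp: exponents_le_def)
  have "(\<lambda>x. f x * q x) \<in> polys_upto (j + k)"
    using q unfolding polys_upto_monomials[of k]
  proof (induction rule: fun_space.span_induct_alt)
    case base
    then show ?case
      by (simp add: polys_upto_zero)
  next
    case (step d u w)
    then obtain l where l: "u = monomial l" "(\<Sum>i\<in>UNIV. l i) \<le> k"
      by (auto simp: exponents_le_def)
    have "(\<lambda>x. f x * u x) \<in> polys_upto (j + k)"
      using m l monomial_in_polys_upto[of "\<lambda>i. m i + l i" "j + k"] by (simp add: monomial_mult sum.distrib)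
    then have "(\<lambda>x. d * (f x * u x) + f x * w x) \<in> polys_upto (j + k)"
      using step(2) by (intro polys_upto_add polys_upto_cmult)
    then show ?case
      by (simp add: algebra_simps)
  qed
  then have "(\<lambda>x. c * (f x * q x) + g x * q x) \<in> polys_upto (j + k)"
    using step(2) by (intro polys_upto_add polys_upto_cmult)
  then show ?case
    by (simp add: algebra_simps)
qed

lemma polys_upto_prod:
  assumes "finite A" "\<And>a. a \<in> A \<Longrightarrow> f a \<in> polys_upto 1"
  shows "(\<lambda>x. \<Prod>a\<in>A. f a x) \<in> polys_upto (card A)"
  using assms
proof (induction rule: finite_induct)
  case empty
  then show ?case
    by (simp add: polys_upto_const)
next
  case (insert a A)
  then show ?case
    using polys_upto_mult[of "f a" 1 "\<lambda>x. \<Prod>a\<in>A. f a x" "card A"] by simp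
qed

lemma shape_spaceI:
  fixes p r :: "real^'n \<Rightarrow> real"
  shows "p \<in> polys_upto (CARD('n) + 1) \<Longrightarrow> r \<in> polys_upto 1 \<Longrightarrow> (\<lambda>x. p x + bubble T x * r x) \<in> shape_space T"
  unfolding shape_space_def by blast

lemma linear_coordinates:
  fixes l :: "real^'n \<Rightarrow> real"
  assumes "linear l"
  shows "l x = (\<Sum>i\<in>UNIV. l (axis i 1) * x $ i)"
proof -
  have "l x = l (\<Sum>i\<in>UNIV. (x $ i) *\<^sub>R axis i 1)"
    using basis_expansion[of x] by (simp add: scalar_mult_eq_scaleR)
  then show ?thesis
    using assms by (simp add: linear_sum linear_cmul mult.commute)
qed

section \<open>A basis of the shape function space\<close>

context framed_simplex
begin

text \<open>Shows that the two summands of the shape function space overlap: constant multiples of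
  the bubble already lie in the polynomial part.\<close>

lemma bubble_in_polys_upto: "bubble (convex hull V) \<in> polys_upto (CARD('n) + 1)"
proof -
  have "bary a \<in> polys_upto 1" for a
  proof -
    have "(\<lambda>x. (\<Sum>i\<in>UNIV. (bary a (axis i 1) - bary a 0) * x $ i) + bary a 0) \<in> polys_upto 1"
      by (intro polys_upto_add polys_upto_sum polys_upto_cmult polys_upto_coordinate polys_upto_const) simp
    then show ?thesis
      by (simp flip: linear_coordinates[OF barycentric_linear])
  qed
  from polys_upto_prod[OF finite_V this] show ?thesis
    by (simp add: bubble_def[abs_def] vertices_hull card_V)
qed

abbreviation "shape_index \<equiv> exponents_le (UNIV :: 'n set) (CARD('n) + 1) <+> (UNIV :: 'n set)"

text \<open>Only the products of the bubble with the coordinates are added to the monomials; the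
  bubble itself is left out because it is already a polynomial of degree at most
  \<open>CARD('n) + 1\<close>.\<close>

definition shape_basis :: "('n \<Rightarrow> nat) + 'n \<Rightarrow> real^'n \<Rightarrow> real" where
  "shape_basis = case_sum monomial (\<lambda>i x. bubble (convex hull V) x * x $ i)"

lemma finite_shape_index: "finite shape_index"
  using card_exponents_le[of "UNIV :: 'n set"] by simp

lemma card_shape_index: "card shape_index = ((2 * CARD('n) + 1) choose (CARD('n) + 1)) + CARD('n)"
  using card_exponents_le[of "UNIV :: 'n set" "CARD('n) + 1"]
  by (simp add: card_Plus mult_2)

text \<open>A relation writes the zero function as \<open>p\<close> plus the bubble times
  \<open>r\<close>. All its means and vertex values are zero, so the edge argument makes
  \<open>r\<close> constant; being linear, \<open>r\<close> is zero, and then \<open>p\<close> is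
  zero as well.\<close>

lemma shape_basis_linear_independent:
  assumes "\<And>x. (\<Sum>i\<in>shape_index. c i * shape_basis i x) = 0"
  shows "\<forall>i\<in>shape_index. c i = 0"
proof -
  let ?M = "exponents_le (UNIV :: 'n set) (CARD('n) + 1)"
  have finM: "finite ?M"
    using card_exponents_le[of "UNIV :: 'n set"] by simp
  define p where "p = (\<lambda>x. \<Sum>m\<in>?M. c (Inl m) * monomial m x)"
  define r where "r = (\<lambda>x::real^'n. \<Sum>i\<in>UNIV. c (Inr i) * x $ i)"
  have zero: "(\<lambda>x. 0) = (\<lambda>x. p x + bubble (convex hull V) x * r x)"
  proof
    fix x
    have "0 = (\<Sum>i\<in>shape_index. c i * shape_basis i x)"
      by (simp only: assms)
    also have "\<dots> = p x + bubble (convex hull V) x * r x"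
      unfolding sum.Plus[OF finM finite]
      by (simp add: shape_basis_def p_def r_def sum_distrib_left mult.left_commute)
    finally show "0 = p x + bubble (convex hull V) x * r x" .
  qed
  have "p \<in> polys_upto (CARD('n) + 1)"
    unfolding p_def
    by (intro polys_upto_sum polys_upto_cmult monomial_in_polys_upto finM) (auto simp: exponents_le_def)
  then have p: "deg_less (CARD('n) + 2) p"
    using deg_less_polys_upto by force
  have lin: "linear r"
    unfolding r_def by (rule linearI) (simp_all add: distrib_left sum.distrib sum_distrib_left mult.left_commute)
  then have blin: "bounded_linear r"
    by (simp add: linear_conv_bounded_linear)
  then have pf_r: "real_polynomial_function r"
    by blast
  have Dr: "dir_deriv w r = (\<lambda>x. r w)" for w
    by (rule dir_deriv_linear[OF blin])
  have "face_mean (convex hull S) (dir_derivs ws (\<lambda>x. 0)) = 0" if S: "S \<subseteq> V" "S \<noteq> {}" for S and ws :: "(real^'n) list"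
  proof -
    have "dir_derivs ws (\<lambda>x::real^'n. 0) = (\<lambda>x. 0)"
      by (induction ws) (simp_all add: dir_deriv_const)
    then show ?thesis
      using face_mean_linear(3)[OF sub_independent[OF S(1)] S(2)] by simp
  qed
  then have edge: "r (i - j) = 0" if "i \<in> V" "j \<in> V" "i \<noteq> j" for i j
    using bubble_part_edge_zero[OF that p pf_r Dr zero] by blast
  have r0: "r w = 0" for w
  proof -
    have "dir_deriv w r = (\<lambda>x. 0)"
      by (rule dir_deriv_zeroI[OF pf_r]) (simp add: Dr edge)
    then show ?thesis
      unfolding Dr by (rule fun_cong)
  qed
  have R: "c (Inr i) = 0" for i
    using r0[of "axis i 1"] by (simp add: r_def axis_def if_distrib[of "\<lambda>x. _ * x"] cong: if_cong)
  have p0: "p x = 0" for x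
    using fun_cong[OF zero, of x] r0 by simp
  have "\<forall>m\<in>?M. c (Inl m) = 0"
  proof (rule monomials_independent[OF finite finM])
    show "(\<Sum>m\<in>?M. c (Inl m) * (\<Prod>i\<in>UNIV. x i ^ m i)) = 0" for x :: "'n \<Rightarrow> real"
      using p0[of "\<chi> i. x i"] by (simp add: p_def monomial_def)
  qed simp
  then show ?thesis
    using R by auto
qed

text \<open>The equality of spans is the form from which the dimension is read off. A polynomial of
  degree at most 1 is split into its constant part, which the bubble sends into the monomials, and
  its coordinates.\<close>

lemma span_shape_basis: "fun_space.span (shape_basis ` shape_index) = fun_space.span (shape_space (convex hull V))"
proof -
  let ?q = "bubble (convex hull V)"
  let ?B = "shape_basis ` shape_index"
  have P: "p \<in> fun_space.span ?B" if "p \<in> polys_upto (CARD('n) + 1)" for p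
  proof -
    have "monomial ` exponents_le UNIV (CARD('n) + 1) \<subseteq> ?B"
      by (force simp: shape_basis_def)
    then show ?thesis
      using that fun_space.span_mono unfolding polys_upto_monomials by blast
  qed
  have Q: "(\<lambda>x. ?q x * r x) \<in> fun_space.span ?B" if "r \<in> polys_upto 1" for r
    using that unfolding polys_upto_monomials
  proof (induction rule: fun_space.span_induct_alt)
    case base
    then show ?case
      using fun_space.span_zero[of ?B] by (simp add: zero_fun_def)
  next
    case (step c f g)
    then obtain m where m: "f = monomial m" "(\<Sum>i\<in>UNIV. m i) \<le> 1"
      by (auto simp: exponents_le_def)
    have "(\<lambda>x. ?q x * f x) \<in> fun_space.span ?B"
    proof (cases "\<exists>i. m i \<noteq> 0")
      case False
      then have "m = (\<lambda>_. 0)"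
        by auto
      then show ?thesis
        using P[OF bubble_in_polys_upto] by (simp add: m monomial_zero)
    next
      case True
      then obtain i where i: "m i \<noteq> 0"
        by blast
      have s: "(\<Sum>l\<in>UNIV. m l) = m i + (\<Sum>l\<in>UNIV - {i}. m l)"
        by (simp add: sum.remove)
      have "m l \<le> (\<Sum>l\<in>UNIV - {i}. m l)" if "l \<noteq> i" for l
        using that by (intro member_le_sum) auto
      \<comment> \<open>The entry at \<open>i\<close> already exhausts the total degree 1, so all
        other entries vanish.\<close>
      then have "m l = (if l = i then 1 else 0)" for l
        using s i m(2) by (cases "l = i") fastforce+
      then have "m = (\<lambda>l. if l = i then 1 else 0)"
        by blast
      then have "(\<lambda>x. ?q x * f x) = shape_basis (Inr i)"
        by (simp add: m(1) shape_basis_def monomial_single)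
      then show ?thesis
        by (auto intro: fun_space.span_base)
    qed
    then have "(\<lambda>x. c * (?q x * f x)) + (\<lambda>x. ?q x * g x) \<in> fun_space.span ?B"
      using step(2) fun_space.span_scale by (intro fun_space.span_add) blast+
    then show ?case
      by (simp add: plus_fun_def algebra_simps)
  qed
  show ?thesis
  proof (rule fun_space.span_eq[THEN iffD2], rule conjI)
    show "?B \<subseteq> fun_space.span (shape_space (convex hull V))"
    proof (intro image_subsetI fun_space.span_base)
      fix i assume "i \<in> shape_index"
      then show "shape_basis i \<in> shape_space (convex hull V)"
      proof (elim PlusE)
        fix m assume m: "m \<in> exponents_le (UNIV :: 'n set) (CARD('n) + 1)" "i = Inl m"
        then have "monomial m \<in> polys_upto (CARD('n) + 1)"
          by (intro monomial_in_polys_upto) (simp add: exponents_le_def)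
        moreover have "shape_basis i = (\<lambda>x. monomial m x + ?q x * 0)"
          by (simp add: m shape_basis_def)
        ultimately show ?thesis
          using shape_spaceI[OF _ polys_upto_zero] by metis
      next
        fix l assume "i = Inr l"
        then have "shape_basis i = (\<lambda>x. 0 + ?q x * x $ l)"
          by (simp add: shape_basis_def)
        then show ?thesis
          using shape_spaceI[OF polys_upto_zero polys_upto_coordinate, of "convex hull V" l] by metis
      qed
    qed
    show "shape_space (convex hull V) \<subseteq> fun_space.span ?B"
    proof
      fix v assume "v \<in> shape_space (convex hull V)"
      then obtain p r where pr: "v = (\<lambda>x. p x + ?q x * r x)" "p \<in> polys_upto (CARD('n) + 1)" "r \<in> polys_upto 1"
        unfolding shape_space_def by blast
      have "p + (\<lambda>x. ?q x * r x) \<in> fun_space.span ?B"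
        by (intro fun_space.span_add P Q pr)
      then show "v \<in> fun_space.span ?B"
        by (simp add: pr(1) plus_fun_def)
    qed
  qed
qed

lemma dim_shape_space:
  "fun_space.dim (shape_space (convex hull V)) = ((2 * CARD('n) + 1) choose (CARD('n) + 1)) + CARD('n)"
proof -
  have ind: "inj_on shape_basis shape_index" "fun_space.independent (shape_basis ` shape_index)"
    using fun_space_independent_image[OF finite_shape_index, of shape_basis] shape_basis_linear_independent by blast+
  have "fun_space.dim (shape_space (convex hull V)) = card (shape_basis ` shape_index)"
    by (rule fun_space.dim_eq_card[OF span_shape_basis]) (rule ind(2))
  then show ?thesis
    using card_image[OF ind(1)] card_shape_index by simp
qed

section \<open>Counting the degrees of freedom\<close>

lemma card_faces_codim:
  assumes "k \<le> CARD('n)"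
  shows "finite (faces_codim (convex hull V) k)"
    and "card (faces_codim (convex hull V) k) = (CARD('n) + 1) choose k"
proof -
  have eq: "faces_codim (convex hull V) k = (hull) convex ` {S. S \<subseteq> V \<and> card S = CARD('n) - k + 1}"
    unfolding faces_codim_def vertices_hull by auto
  \<comment> \<open>A face determines its vertices as its extreme points, so faces can be counted as
    subsets of \<open>V\<close>.\<close>
  have "inj_on ((hull) convex) {S. S \<subseteq> V \<and> card S = CARD('n) - k + 1}"
  proof (rule inj_on_inverseI[where g=vertices])
    fix S assume "S \<in> {S. S \<subseteq> V \<and> card S = CARD('n) - k + 1}"
    then show "vertices (convex hull S) = S"
      using extreme_point_of_convex_hull_affine_independent[OF sub_independent] by (auto simp: vertices_def)
  qed
  then have "card (faces_codim (convex hull V) k) = (CARD('n) + 1) choose (CARD('n) - k + 1)"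
    unfolding eq by (simp add: card_image n_subsets finite_V card_V)
  then show "card (faces_codim (convex hull V) k) = (CARD('n) + 1) choose k"
    using assms binomial_symmetric[of k "CARD('n) + 1"] by (simp add: Suc_diff_le)
  show "finite (faces_codim (convex hull V) k)"
    unfolding eq using finite_V by simp
qed

text \<open>The multi-indices are supported on \<open>{1..k}\<close> with sum
  \<open>CARD('n) + 1 - k\<close>, so stars and bars gives
  \<open>(k - 1) + (CARD('n) + 1 - k) = CARD('n)\<close> on top.\<close>

lemma card_face_exponents:
  assumes k: "1 \<le> k" "k \<le> CARD('n)"
  defines "E \<equiv> {\<alpha> \<in> multi_indices CARD('n) k. (\<Sum>i=1..CARD('n). \<alpha> i) = CARD('n) + 1 - k}"
  shows "finite E" "card E = CARD('n) choose (CARD('n) + 1 - k)"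
proof -
  \<comment> \<open>The last index \<open>k\<close> is the slack variable, leaving
    \<open>k - 1\<close> free entries.\<close>
  have ins: "insert k {1..<k} = {1..k}"
    using k by auto
  have "E = {\<alpha>. (\<forall>i. i \<notin> {1..k} \<longrightarrow> \<alpha> i = 0) \<and> (\<Sum>i\<in>{1..k}. \<alpha> i) = CARD('n) + 1 - k}"
  proof -
    have sum_eq: "(\<Sum>i=1..CARD('n). \<alpha> i) = (\<Sum>i=1..k. \<alpha> i)" if "\<forall>i. i \<notin> {1..k} \<longrightarrow> \<alpha> i = 0" for \<alpha> :: "nat \<Rightarrow> nat"
      using that k by (intro sum.mono_neutral_right) auto
    have "\<alpha> \<in> multi_indices CARD('n) k \<longleftrightarrow> (\<forall>i. i \<notin> {1..k} \<longrightarrow> \<alpha> i = 0)" for \<alpha>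
    proof
      assume \<alpha>: "\<alpha> \<in> multi_indices CARD('n) k"
      show "\<forall>i. i \<notin> {1..k} \<longrightarrow> \<alpha> i = 0"
      proof (intro allI impI)
        fix i assume "i \<notin> {1..k}"
        then show "\<alpha> i = 0"
          using \<alpha> by (cases "i \<in> {1..CARD('n)}") (auto simp: multi_indices_def)
      qed
    qed (use k in \<open>auto simp: multi_indices_def\<close>)
    then show ?thesis
      unfolding E_def by (simp only: sum_eq cong: conj_cong)
  qed
  then show "finite E" "card E = CARD('n) choose (CARD('n) + 1 - k)"
    using card_exponents_eq[of "{1..<k}" k "CARD('n) + 1 - k"] k unfolding ins by simp_all
qed

text \<open>Faces times multi-indices, summed over the codimension, is Vandermonde's convolution
  less one term; the \<open>CARD('n) + 1\<close> vertex values make up for that term and contribute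
  the remaining \<open>CARD('n)\<close>.\<close>

lemma card_dof_indices:
  shows "finite (dof_indices (convex hull V))"
    and "card (dof_indices (convex hull V)) = ((2 * CARD('n) + 1) choose (CARD('n) + 1)) + CARD('n)"
proof -
  let ?n = "CARD('n)" and ?T = "convex hull V"
  define E where "E = (\<lambda>k. {\<alpha> \<in> multi_indices ?n k. (\<Sum>i=1..?n. \<alpha> i) = ?n + 1 - k})"
  define I where "I = (SIGMA k:{1..?n}. faces_codim ?T k \<times> E k)"
  let ?f = "\<lambda>(k, F, \<alpha>). Face_Dof k F \<alpha>"
  have eq: "dof_indices ?T = ?f ` I \<union> Vertex_Dof ` V"
    unfolding dof_indices_def I_def E_def vertices_hull by (auto simp: image_iff)
  have finE: "finite (E k)" "card (E k) = ?n choose (?n + 1 - k)" if "k \<in> {1..?n}" for k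
    using card_face_exponents[of k] that unfolding E_def by auto
  have finI: "finite I"
    unfolding I_def using finE card_faces_codim(1) by (intro finite_SigmaI finite_cartesian_product) auto
  show "finite (dof_indices ?T)"
    unfolding eq using finI finite_V by simp
  have "card I = (\<Sum>k\<in>{1..?n}. card (faces_codim ?T k \<times> E k))"
    unfolding I_def using finE card_faces_codim(1) by (intro card_SigmaI) auto
  also have "\<dots> = (\<Sum>k\<in>{1..?n}. ((?n + 1) choose k) * (?n choose (?n + 1 - k)))"
    using finE card_faces_codim(2) by (intro sum.cong) (auto simp: card_cartesian_product)
  \<comment> \<open>Vandermonde's sum also runs over \<open>k = 0\<close>, where the second binomial
    coefficient is zero, and over \<open>k = CARD('n) + 1\<close>, whose term is 1.\<close>
  finally have "card I + 1 = (\<Sum>k\<le>?n + 1. ((?n + 1) choose k) * (?n choose (?n + 1 - k)))"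
  proof -
    assume I: "card I = (\<Sum>k\<in>{1..?n}. ((?n + 1) choose k) * (?n choose (?n + 1 - k)))"
    have "{..?n + 1} = insert 0 (insert (?n + 1) {1..?n})"
      by auto
    then show ?thesis
      by (simp add: I)
  qed
  also have "\<dots> = (2 * ?n + 1) choose (?n + 1)"
    by (simp add: vandermonde mult_2)
  finally have "card I + 1 = (2 * ?n + 1) choose (?n + 1)" .
  moreover have "card (?f ` I) = card I" "card (Vertex_Dof ` V) = card V"
    by (auto intro!: card_image simp: inj_on_def)
  moreover have "card (?f ` I \<union> Vertex_Dof ` V) = card (?f ` I) + card (Vertex_Dof ` V)"
    using finI finite_V by (intro card_Un_disjoint) auto
  ultimately show "card (dof_indices ?T) = ((2 * ?n + 1) choose (?n + 1)) + ?n"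
    unfolding eq using card_V by simp
qed

end

theorem theorem2p3:
  fixes T :: "(real^'n) set" and \<nu> :: "(real^'n) set \<Rightarrow> nat \<Rightarrow> real^'n"
  assumes "int CARD('n) simplex T"
    and "normal_frame T \<nu>"
  shows "unisolvent (dof_indices T) (dof \<nu>) (shape_space T)"
proof -
  obtain V where V: "\<not> affine_dependent V" "int (card V) = int CARD('n) + 1" "T = convex hull V"
    using assms(1) unfolding simplex by blast
  interpret framed_simplex V \<nu>
    using V assms(2) by unfold_locales auto
  show ?thesis
    unfolding unisolvent_def V(3) using card_dof_indices dim_shape_space dofs_injective by simp
qed

end
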